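(* Up to isomorphism, there are infinitely many complex $4$-dimensional symmetric Leibniz algebras that are neither nilpotent nor Lie algebras, and they are described in terms of $3$ one-parameter families and $6$ additional isomorphism classes. Explicitly, every complex $4$-dimensional symmetric Leibniz algebra that is not nilpotent and not a Lie algebra is isomorphic to one algebra from the following list (with $\alpha\in\mathbb{C}$): \begin{itemize} \item $\mathfrak{L}_{02}$: $e_1e_1=e_4,\ e_1e_2=-e_2,\ e_1e_3=e_3,\ e_2e_1=e_2,\ e_2e_3=e_4,\ e_3e_1=-e_3,\ e_3e_2=-e_4$; \item $\mathfrak{L}_{14}$: $e_1e_3=-e_3,\ e_2e_2=e_4,\ e_3e_1=e_3$; \item $\mathfrak{L}_{15}^{\alpha}$: $e_1e_1=\alpha e_4,\ e_1e_2=e_4,\ e_1e_3=-e_3,\ e_2e_2=e_4,\ e_3e_1=e_3$; \item $\mathfrak{L}_{16}$: $e_1e_1=-2e_4,\ e_1e_3=-e_3,\ e_2e_2=e_4,\ e_3e_1=e_3$; \item $\mathfrak{L}_{24}^{\alpha}$: $e_1e_1=e_4,\ e_1e_2=-e_2,\ e_1e_3=-\alpha e_3,\ e_2e_1=e_2,\ e_3e_1=\alpha e_3$; \item $\mathfrak{L}_{27}$: $e_1e_2=-e_2,\ e_1e_3=e_4,\ e_2e_1=e_2$; \item $\mathfrak{L}_{30}$: $e_1e_1=e_4,\ e_1e_2=-e_2-e_3,\ e_1e_3=-e_3,\ e_2e_1=e_2+e_3,\ e_3e_1=e_3$; \item $\mathfrak{L}_{35}^{\alpha}$ with $\alpha\neq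 -1$: $e_1e_2=\alpha e_3,\ e_1e_4=-e_4,\ e_2e_1=e_3,\ e_4e_1=e_4$; \item $\mathfrak{L}_{36}$: $e_1e_1=e_3,\ e_1e_2=-e_3,\ e_1e_4=-e_4,\ e_2e_1=e_3,\ e_4e_1=e_4$. \end{itemize}
   Context: An algebra is a complex vector space with a bilinear product. A symmetric Leibniz algebra is an algebra satisfying the identities $x(yz)=(xy)z+y(xz)$ and $(xy)z=(xz)y+x(yz)$. An algebra is nilpotent if there is $k$ such that every product of $k$ elements, with any bracketing, is zero. A symmetric Leibniz algebra is a Lie algebra if its product is alternating ($xx=0$ for all $x$). Each listed algebra has basis $e_1,e_2,e_3,e_4$, and all products of basis elements that are not listed are zero. *)

theory Defs
  imports "HOL-Analysis.Analysis"
begin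

locale complex_algebra = vector_space smul
  for smul :: "complex \<Rightarrow> 'a::ab_group_add \<Rightarrow> 'a" +
  fixes mul :: "'a \<Rightarrow> 'a \<Rightarrow> 'a"
  assumes linear_mul_left: "Vector_Spaces.linear smul smul (\<lambda>x. mul x y)"
    and linear_mul_right: "Vector_Spaces.linear smul smul (\<lambda>y. mul x y)"

locale symmetric_leibniz_algebra = complex_algebra +
  assumes left_leibniz: "mul x (mul y z) = mul (mul x y) z + mul y (mul x z)"
    and right_leibniz: "mul (mul x y) z = mul (mul x z) y + mul x (mul y z)"

text \<open>\<open>is_product mul k x\<close>: \<open>x\<close> is a product of \<open>k\<close> elements with some bracketing.\<close>

inductive is_product :: "('a \<Rightarrow> 'a \<Rightarrow> 'a) \<Rightarrow> nat \<Rightarrow> 'a \<Rightarrow> bool" for mul where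
  "is_product mul 1 x"
| "is_product mul i x \<Longrightarrow> is_product mul j y \<Longrightarrow> is_product mul (i + j) (mul x y)"

text \<open>The bound \<open>k \<ge> 1\<close> is needed: there is no product of zero elements, so \<open>k = 0\<close> would make
  every algebra nilpotent.\<close>

definition nilpotent_algebra :: "('a::zero \<Rightarrow> 'a \<Rightarrow> 'a) \<Rightarrow> bool" where
  "nilpotent_algebra mul \<longleftrightarrow> (\<exists>k\<ge>1. \<forall>x. is_product mul k x \<longrightarrow> x = 0)"

definition alternating :: "('a::zero \<Rightarrow> 'a \<Rightarrow> 'a) \<Rightarrow> bool" where
  "alternating mul \<longleftrightarrow> (\<forall>x. mul x x = 0)"

text \<open>A symmetric Leibniz algebra is a Lie algebra iff its product is alternating. As the dimension
  is nonzero, \<open>dim UNIV = 4\<close> entails that the space is finite-dimensional.\<close>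

definition nonnilpotent_nonlie_symmetric_leibniz_4 ::
  "(complex \<Rightarrow> 'a::ab_group_add \<Rightarrow> 'a) \<Rightarrow> ('a \<Rightarrow> 'a \<Rightarrow> 'a) \<Rightarrow> bool" where
  "nonnilpotent_nonlie_symmetric_leibniz_4 smul mul \<longleftrightarrow>
     symmetric_leibniz_algebra smul mul \<and> vector_space.dim smul UNIV = 4 \<and>
     \<not> nilpotent_algebra mul \<and> \<not> alternating mul"

definition algebra_isomorphic ::
  "(complex \<Rightarrow> 'a::ab_group_add \<Rightarrow> 'a) \<Rightarrow> ('a \<Rightarrow> 'a \<Rightarrow> 'a) \<Rightarrow>
   (complex \<Rightarrow> 'b::ab_group_add \<Rightarrow> 'b) \<Rightarrow> ('b \<Rightarrow> 'b \<Rightarrow> 'b) \<Rightarrow> bool" where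
  "algebra_isomorphic smul1 mul1 smul2 mul2 \<longleftrightarrow>
     (\<exists>f. Vector_Spaces.linear smul1 smul2 f \<and> bij f \<and>
          (\<forall>x y. f (mul1 x y) = mul2 (f x) (f y)))"

text \<open>The listed algebras live on \<open>complex ^ 4\<close>. In the index type \<open>4\<close> the numeral \<open>4\<close> equals \<open>0\<close>,
  so \<open>1, 2, 3, 4\<close> are its four distinct elements.\<close>

type_synonym product4 = "complex ^ 4 \<Rightarrow> complex ^ 4 \<Rightarrow> complex ^ 4"

abbreviation e1 :: "complex ^ 4" where "e1 \<equiv> axis 1 1"
abbreviation e2 :: "complex ^ 4" where "e2 \<equiv> axis 2 1"
abbreviation e3 :: "complex ^ 4" where "e3 \<equiv> axis 3 1"
abbreviation e4 :: "complex ^ 4" where "e4 \<equiv> axis 4 1"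

text \<open>The bilinear product with \<open>e\<^sub>i e\<^sub>j = v\<close> for each entry \<open>(i, j, v)\<close> of the table, and
  \<open>e\<^sub>i e\<^sub>j = 0\<close> for the pairs \<open>(i, j)\<close> not in it; no pair may be entered twice.\<close>

definition product_of_table :: "(4 \<times> 4 \<times> (complex ^ 4)) list \<Rightarrow> product4" where
  "product_of_table T x y = (\<Sum>(i, j, v) \<leftarrow> T. (x $ i * y $ j) *s v)"

definition L02 :: product4 where
  "L02 = product_of_table
     [(1, 1, e4), (1, 2, - e2), (1, 3, e3), (2, 1, e2), (2, 3, e4), (3, 1, - e3), (3, 2, - e4)]"

definition L14 :: product4 where
  "L14 = product_of_table [(1, 3, - e3), (2, 2, e4), (3, 1, e3)]"

definition L15 :: "complex \<Rightarrow> product4" where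
  "L15 \<alpha> = product_of_table [(1, 1, \<alpha> *s e4), (1, 2, e4), (1, 3, - e3), (2, 2, e4), (3, 1, e3)]"

definition L16 :: product4 where
  "L16 = product_of_table [(1, 1, - 2 *s e4), (1, 3, - e3), (2, 2, e4), (3, 1, e3)]"

definition L24 :: "complex \<Rightarrow> product4" where
  "L24 \<alpha> = product_of_table
     [(1, 1, e4), (1, 2, - e2), (1, 3, - \<alpha> *s e3), (2, 1, e2), (3, 1, \<alpha> *s e3)]"

definition L27 :: product4 where
  "L27 = product_of_table [(1, 2, - e2), (1, 3, e4), (2, 1, e2)]"

definition L30 :: product4 where
  "L30 = product_of_table
     [(1, 1, e4), (1, 2, - e2 - e3), (1, 3, - e3), (2, 1, e2 + e3), (3, 1, e3)]"

definition L35 :: "complex \<Rightarrow> product4" where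
  "L35 \<alpha> = product_of_table [(1, 2, \<alpha> *s e3), (1, 4, - e4), (2, 1, e3), (4, 1, e4)]"

definition L36 :: product4 where
  "L36 = product_of_table [(1, 1, e3), (1, 2, - e3), (1, 4, - e4), (2, 1, e3), (4, 1, e4)]"

datatype list_entry =
    Entry02 | Entry14 | Entry15 | Entry16 | Entry24 | Entry27 | Entry30 | Entry35 | Entry36

primrec algebras_of_entry :: "list_entry \<Rightarrow> product4 set" where
  "algebras_of_entry Entry02 = {L02}"
| "algebras_of_entry Entry14 = {L14}"
| "algebras_of_entry Entry15 = {L15 \<alpha> | \<alpha>. True}"
| "algebras_of_entry Entry16 = {L16}"
| "algebras_of_entry Entry24 = {L24 \<alpha> | \<alpha>. True}"
| "algebras_of_entry Entry27 = {L27}"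
| "algebras_of_entry Entry30 = {L30}"
| "algebras_of_entry Entry35 = {L35 \<alpha> | \<alpha>. \<alpha> \<noteq> - 1}"
| "algebras_of_entry Entry36 = {L36}"

text \<open>Every 4-dimensional complex vector space is isomorphic to \<open>complex ^ 4\<close>, so isomorphism classes
  of 4-dimensional algebras are counted on that space.\<close>

definition isomorphism_relation4 :: "product4 rel" where
  "isomorphism_relation4 = {(m, m'). algebra_isomorphic (*s) m (*s) m'}"

end

theory Submission
  imports Defs
begin

text \<open>
  Squares in a symmetric Leibniz algebra annihilate the whole algebra, hence so do all
  anticommutators \<open>xy + yx\<close>, and every product anticommutes with every element. The algebra is thus
  a Lie algebra together with a symmetric form whose values are annihilating and which vanishes on
  products. If the algebra is not Lie, some \<open>a\<close> has \<open>aa \<noteq> 0\<close>, and if it is not nilpotent, some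
  product \<open>(xy)z\<close> is not annihilating.

  In dimension four little room is left. If the annihilator is larger than the line of \<open>aa\<close>, then
  \<open>a\<close> and one more vector \<open>b\<close> generate everything modulo the annihilator, and \<open>ab\<close> has to be an
  eigenvector of \<open>a\<close> modulo \<open>aa\<close> (\<open>listed_if_large_annihilator\<close>). Otherwise the annihilator is the line of
  \<open>e = aa\<close>, and the symmetric form is scalar valued; let \<open>R\<close> be its radical. All products lie in
  \<open>R\<close>, so \<open>R\<close> is larger than the line of \<open>e\<close>. If \<open>R\<close> has dimension two, or if \<open>R\<close> has dimension
  three and is not abelian modulo \<open>e\<close>, there are \<open>x\<close> and \<open>r\<close> with \<open>xr = - r\<close> such that the remaining
  basis vector \<open>z\<close> can be corrected to satisfy \<open>zr = 0\<close> (\<open>form_basis_if_eigenvector\<close>). Then the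
  algebra is given by the bilinear form, not necessarily symmetric, by which \<open>x\<close> and \<open>z\<close> multiply
  into the line of \<open>e\<close>. Substitutions \<open>x + tz\<close>, \<open>sz\<close>, \<open>we\<close> normalize this form
  (\<open>listed_if_form_basis\<close>); this is where the entries of \<open>L14\<close>, \<open>L15 \<alpha>\<close>, \<open>L16\<close>, \<open>L27\<close>, \<open>L35 \<alpha>\<close>,
  \<open>L36\<close> and the algebra \<open>L24 0\<close> come from. Finally, if \<open>R\<close> has dimension three and is abelian modulo
  \<open>e\<close>, the algebra is determined by a triangular form of multiplication by \<open>a\<close> on \<open>R\<close> and by the
  product of the two basis vectors of \<open>R\<close> other than \<open>e\<close> (\<open>listed_if_triangular_normalized\<close>); this
  gives \<open>L02\<close>, \<open>L24 \<alpha>\<close> and \<open>L30\<close>, and once more a bilinear form if \<open>0\<close> is an eigenvalue on \<open>R\<close>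
  modulo \<open>e\<close>.

  That an algebra cannot belong to two entries is seen from properties that mention the product only
  (\<open>entry_of\<close>). Infinitely many classes occur already in the family \<open>L35 \<alpha>\<close>, where \<open>\<alpha>\<close> is an
  invariant (\<open>operator_ratio_L35\<close>).
\<close>

section \<open>Product tables in coordinates\<close>

lemma product_of_table_nth:
  "product_of_table T x y $ k = (\<Sum>(i, j, v) \<leftarrow> T. (x $ i * y $ j) * v $ k)"
  by (induction T) (auto simp: product_of_table_def)

text \<open>Rewriting with these rules turns an equation between products of vectors in a listed algebra
  into four polynomial equations between coordinates.\<close>

lemmas table_coordinates = L02_def L14_def L15_def L16_def L24_def L27_def L30_def L35_def L36_def
  vec_eq_iff forall_4 product_of_table_nth axis_def

lemma complex_algebra_product_of_table: "complex_algebra (*s) (product_of_table T)"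
proof unfold_locales
qed (induction T; simp add: product_of_table_def vec_eq_iff algebra_simps split_def)+

lemma dim_complex_4: "vector_space.dim (*s) (UNIV :: (complex ^ 4) set) = 4"
  using vec.dim_UNIV by (simp add: card_cart_basis)

section \<open>The listed algebras are symmetric Leibniz, not nilpotent and not Lie\<close>

text \<open>Multiplying \<open>y\<close> by \<open>x\<close> from the left again and again gives nonzero multiples of \<open>y\<close>, which are
  nonzero products of arbitrarily many elements.\<close>

lemma not_nilpotent_if_eigenvector:
  assumes "mul x y = smul c y" and "c \<noteq> 0" and "y \<noteq> 0" and "complex_algebra smul mul"
  shows "\<not> nilpotent_algebra mul"
proof -
  interpret complex_algebra smul mul by fact
  have "\<exists>d. d \<noteq> 0 \<and> is_product mul (Suc n) (smul d y)" for n
  proof (induction n)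
    case 0
    show ?case using is_product.intros(1)[of mul "smul 1 y"] by (intro exI[of _ 1]) simp
  next
    case (Suc n)
    then obtain d where d: "d \<noteq> 0" "is_product mul (Suc n) (smul d y)" by blast
    have "mul x (smul d y) = smul (d * c) y"
      using linear_mul_right[of x] assms(1) by (simp add: Vector_Spaces.linear_iff)
    then show ?case
      using is_product.intros(2)[OF is_product.intros(1) d(2), of x] d(1) \<open>c \<noteq> 0\<close>
      by (intro exI[of _ "d * c"]) simp
  qed
  then show ?thesis
    unfolding nilpotent_algebra_def
    by (metis One_nat_def Suc_le_D assms(3) scale_eq_0_iff)
qed

lemma algebras_of_entry_satisfy_hypotheses:
  assumes "m \<in> algebras_of_entry entry"
  shows "nonnilpotent_nonlie_symmetric_leibniz_4 (*s) m"
proof -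
  have alg: "complex_algebra (*s) m"
    using assms complex_algebra_product_of_table
    by (cases entry)
      (auto simp: L02_def L14_def L15_def L16_def L24_def L27_def L30_def L35_def L36_def)
  have leibniz: "symmetric_leibniz_algebra_axioms m"
    using assms
    by (cases entry)
      (auto simp: symmetric_leibniz_algebra_axioms_def table_coordinates algebra_simps)
  \<comment> \<open>In every table \<open>e1\<close> acts on some basis vector from the left with eigenvalue \<open>-1\<close>.\<close>
  have "m e1 e2 = (- 1) *s e2 \<or> m e1 e3 = (- 1) *s e3 \<or> m e1 e4 = (- 1) *s e4"
    using assms by (cases entry) (auto simp: table_coordinates)
  then have not_nil: "\<not> nilpotent_algebra m"
    using not_nilpotent_if_eigenvector[OF _ _ _ alg]
    by (metis axis_eq_0_iff neg_equal_0_iff_equal zero_neq_one)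
  have not_alt: "\<not> alternating m"
  proof
    assume "alternating m"
    \<comment> \<open>\<open>e1 + e3\<close> is needed in the table of \<open>L27\<close>, \<open>e1 + e2\<close> in those of \<open>L35 \<alpha>\<close>, where its square is
      \<open>(\<alpha> + 1) e3\<close>.\<close>
    then have "m e1 e1 = 0 \<and> m e2 e2 = 0 \<and> m (e1 + e2) (e1 + e2) = 0 \<and> m (e1 + e3) (e1 + e3) = 0"
      by (simp add: alternating_def)
    then show False
      using assms
      by (cases entry) (auto simp: table_coordinates eq_neg_iff_add_eq_0 add.commute)
  qed
  show ?thesis
    unfolding nonnilpotent_nonlie_symmetric_leibniz_4_def
    using alg leibniz not_nil not_alt dim_complex_4 by (simp add: symmetric_leibniz_algebra.intro)
qed

section \<open>Invariants that separate the entries\<close>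

definition products_multiply_to_zero :: "('a::ab_group_add \<Rightarrow> 'a \<Rightarrow> 'a) \<Rightarrow> bool" where
  "products_multiply_to_zero mul \<longleftrightarrow> (\<forall>x y z w. mul (mul x y) (mul z w) = 0)"

definition square_zero_multiplication_by_nonnull :: "('a::ab_group_add \<Rightarrow> 'a \<Rightarrow> 'a) \<Rightarrow> bool" where
  "square_zero_multiplication_by_nonnull mul \<longleftrightarrow>
     (\<exists>y. mul y y \<noteq> 0 \<and> (\<forall>x. mul y (mul y x) = 0))"

definition nonzero_annihilating_commutator :: "('a::ab_group_add \<Rightarrow> 'a \<Rightarrow> 'a) \<Rightarrow> bool" where
  "nonzero_annihilating_commutator mul \<longleftrightarrow>
     (\<exists>x y. mul x y \<noteq> mul y x \<and> (\<forall>z. mul (mul x y - mul y x) z = 0))"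

definition eigenvalue_one_of_anticommuting :: "('a::ab_group_add \<Rightarrow> 'a \<Rightarrow> 'a) \<Rightarrow> bool" where
  "eigenvalue_one_of_anticommuting mul \<longleftrightarrow>
     (\<exists>x y. (\<forall>z. mul x z + mul z x = 0) \<and> mul y x = y \<and> y \<noteq> 0)"

definition null_vectors_anticommute :: "('a::ab_group_add \<Rightarrow> 'a \<Rightarrow> 'a) \<Rightarrow> bool" where
  "null_vectors_anticommute mul \<longleftrightarrow>
     (\<forall>x y. mul x x = 0 \<and> mul y y = 0 \<longrightarrow> mul x y + mul y x = 0)"

definition nonzero_idempotent_multiplication :: "('a::ab_group_add \<Rightarrow> 'a \<Rightarrow> 'a) \<Rightarrow> bool" where
  "nonzero_idempotent_multiplication mul \<longleftrightarrow>
     (\<exists>x. (\<forall>y. mul (mul y x) x = mul y x) \<and> (\<exists>y. mul y x \<noteq> 0))"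

definition eigenvalue_one_semisimple :: "('a::ab_group_add \<Rightarrow> 'a \<Rightarrow> 'a) \<Rightarrow> bool" where
  "eigenvalue_one_semisimple mul \<longleftrightarrow>
     (\<forall>x y. mul (mul y x - y) x = mul y x - y \<longrightarrow> mul y x = y)"

text \<open>A decision tree whose tests are statements about the product alone, so that the result is the
  same for isomorphic algebras. Only in \<open>L02\<close> two products have a nonzero product. In the branch of
  the entries 14, 15 and 16 the bilinear form on \<open>e1\<close> and \<open>e2\<close> has \<open>e2e2 \<noteq> 0\<close>; it is not symmetric
  in entry 15 and has rank one in entry 14. Of the remaining algebras, those whose symmetric form
  has rank one form the branch of the entries 24, 30 and 36.\<close>

definition entry_of :: "('a::ab_group_add \<Rightarrow> 'a \<Rightarrow> 'a) \<Rightarrow> list_entry" where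
  "entry_of mul =
     (if \<not> products_multiply_to_zero mul then Entry02
      else if square_zero_multiplication_by_nonnull mul then
        (if nonzero_annihilating_commutator mul then Entry15
         else if eigenvalue_one_of_anticommuting mul then Entry14 else Entry16)
      else if null_vectors_anticommute mul then
        (if nonzero_annihilating_commutator mul then Entry36
         else if eigenvalue_one_semisimple mul then Entry24 else Entry30)
      else if nonzero_idempotent_multiplication mul then Entry27 else Entry35)"

text \<open>For \<open>x = e1\<close> in \<open>L35 \<alpha>\<close> both sides of the equation vanish unless \<open>y\<close> has an \<open>e2\<close> coordinate,
  and for \<open>y = e2\<close> they are \<open>\<alpha> e3\<close> and \<open>\<beta> e3\<close>. The eigenvalue condition makes \<open>x\<close> agree with \<open>e1\<close> in
  this respect, so that \<open>\<alpha>\<close> can be recovered from the product.\<close>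

definition operator_ratio ::
  "(complex \<Rightarrow> 'a::ab_group_add \<Rightarrow> 'a) \<Rightarrow> ('a \<Rightarrow> 'a \<Rightarrow> 'a) \<Rightarrow> complex \<Rightarrow> bool" where
  "operator_ratio smul mul \<beta> \<longleftrightarrow>
     (\<exists>x. (\<exists>y. y \<noteq> 0 \<and> mul y x = y) \<and>
          (\<forall>y. mul x (mul x y) + mul x y = smul \<beta> (mul y x - mul (mul y x) x)))"

context includes lifting_syntax begin

text \<open>The graph of an isomorphism relates all the operations that occur in the invariants, so
  transfer along it carries each invariant from one algebra to the other.\<close>

lemma isomorphism_relator:
  assumes "algebra_isomorphic smul mul smul' mul'"
  obtains A :: "'a::ab_group_add \<Rightarrow> 'b::ab_group_add \<Rightarrow> bool"
  where "bi_total A" "bi_unique A" "A 0 0" "(A ===> A ===> A) (+) (+)" "(A ===> A ===> A) (-) (-)"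
    "((=) ===> A ===> A) smul smul'" "(A ===> A ===> A) mul mul'"
proof -
  obtain f where lin: "Vector_Spaces.linear smul smul' f" and bij: "bij f"
    and f_mul: "\<And>x y. f (mul x y) = mul' (f x) (f y)"
    using assms unfolding algebra_isomorphic_def by blast
  interpret Vector_Spaces.linear smul smul' f by (rule lin)
  show thesis
    by (rule that[of "\<lambda>x y. y = f x"])
      (use bij in \<open>auto simp: bi_total_def bi_unique_def rel_fun_def zero add diff scale f_mul
        bij_def surj_def dest: injD\<close>)
qed

lemma entry_of_transfer:
  fixes A :: "'a::ab_group_add \<Rightarrow> 'b::ab_group_add \<Rightarrow> bool"
  assumes [transfer_rule]: "bi_total A" "bi_unique A" "A 0 0" "(A ===> A ===> A) (+) (+)"
    "(A ===> A ===> A) (-) (-)" "(A ===> A ===> A) mul mul'"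
  shows "entry_of mul = entry_of mul'"
  unfolding entry_of_def products_multiply_to_zero_def square_zero_multiplication_by_nonnull_def
    nonzero_annihilating_commutator_def eigenvalue_one_of_anticommuting_def
    null_vectors_anticommute_def nonzero_idempotent_multiplication_def
    eigenvalue_one_semisimple_def
  by transfer_prover

lemma operator_ratio_transfer:
  fixes A :: "'a::ab_group_add \<Rightarrow> 'b::ab_group_add \<Rightarrow> bool"
  assumes [transfer_rule]: "bi_total A" "bi_unique A" "A 0 0" "(A ===> A ===> A) (+) (+)"
    "(A ===> A ===> A) (-) (-)" "((=) ===> A ===> A) smul smul'" "(A ===> A ===> A) mul mul'"
  shows "operator_ratio smul mul \<beta> = operator_ratio smul' mul' \<beta>"
  unfolding operator_ratio_def by transfer_prover

end

lemma entry_of_isomorphic: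
  "algebra_isomorphic smul mul smul' mul' \<Longrightarrow> entry_of mul = entry_of mul'"
  by (erule isomorphism_relator) (rule entry_of_transfer)

lemma operator_ratio_isomorphic:
  "algebra_isomorphic smul mul smul' mul' \<Longrightarrow>
     operator_ratio smul mul \<beta> = operator_ratio smul' mul' \<beta>"
  by (erule isomorphism_relator) (rule operator_ratio_transfer)

lemma products_multiply_to_zero_listed:
  "\<not> products_multiply_to_zero L02" "products_multiply_to_zero L14"
  "products_multiply_to_zero (L15 \<alpha>)" "products_multiply_to_zero L16"
  "products_multiply_to_zero (L24 \<alpha>)" "products_multiply_to_zero L27"
  "products_multiply_to_zero L30" "products_multiply_to_zero (L35 \<alpha>)"
  "products_multiply_to_zero L36"
proof -
  have "L02 (L02 e2 e1) (L02 e1 e3) \<noteq> 0" by (simp add: table_coordinates)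
  then show "\<not> products_multiply_to_zero L02" unfolding products_multiply_to_zero_def by blast
qed (simp_all add: products_multiply_to_zero_def table_coordinates)

text \<open>In the first three algebras \<open>e2\<close> is a witness. In the others only vectors with a nonzero \<open>e1\<close>
  coordinate have nonzero squares, and the basis vector used in the proof is an eigenvector of their
  left multiplications for a nonzero eigenvalue.\<close>

lemma square_zero_multiplication_by_nonnull_listed:
  "square_zero_multiplication_by_nonnull L14" "square_zero_multiplication_by_nonnull (L15 \<alpha>)"
  "square_zero_multiplication_by_nonnull L16" "\<not> square_zero_multiplication_by_nonnull (L24 \<alpha>)"
  "\<not> square_zero_multiplication_by_nonnull L27" "\<not> square_zero_multiplication_by_nonnull L30"
  "\<not> square_zero_multiplication_by_nonnull (L35 \<alpha>)" "\<not> square_zero_multiplication_by_nonnull L36"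
proof -
  show "square_zero_multiplication_by_nonnull L14" "square_zero_multiplication_by_nonnull (L15 \<alpha>)"
    "square_zero_multiplication_by_nonnull L16"
    unfolding square_zero_multiplication_by_nonnull_def
    by (rule exI[of _ e2], simp add: table_coordinates)+
next
  have "L24 \<alpha> y y = 0" if "L24 \<alpha> y (L24 \<alpha> y e2) = 0" for y
    using that by (auto simp: table_coordinates)
  moreover have "L27 y y = 0" if "L27 y (L27 y e2) = 0" for y
    using that by (auto simp: table_coordinates)
  moreover have "L30 y y = 0" if "L30 y (L30 y e3) = 0" for y
    using that by (auto simp: table_coordinates)
  moreover have "L35 \<alpha> y y = 0" if "L35 \<alpha> y (L35 \<alpha> y e4) = 0" for y
    using that by (auto simp: table_coordinates)
  moreover have "L36 y y = 0" if "L36 y (L36 y e4) = 0" for y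
    using that by (auto simp: table_coordinates)
  ultimately show "\<not> square_zero_multiplication_by_nonnull (L24 \<alpha>)"
    "\<not> square_zero_multiplication_by_nonnull L27" "\<not> square_zero_multiplication_by_nonnull L30"
    "\<not> square_zero_multiplication_by_nonnull (L35 \<alpha>)"
    "\<not> square_zero_multiplication_by_nonnull L36"
    unfolding square_zero_multiplication_by_nonnull_def by blast+
qed

text \<open>In \<open>L15 \<alpha>\<close> and \<open>L36\<close> the commutator of \<open>e1\<close> and \<open>e2\<close> lies in the annihilator. In the other
  four algebras multiplication by \<open>e1\<close> is injective on commutators.\<close>

lemma nonzero_annihilating_commutator_listed:
  "nonzero_annihilating_commutator (L15 \<alpha>)" "nonzero_annihilating_commutator L36"
  "\<not> nonzero_annihilating_commutator L14" "\<not> nonzero_annihilating_commutator L16"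
  "\<not> nonzero_annihilating_commutator (L24 \<alpha>)" "\<not> nonzero_annihilating_commutator L30"
proof -
  show "nonzero_annihilating_commutator (L15 \<alpha>)" "nonzero_annihilating_commutator L36"
    unfolding nonzero_annihilating_commutator_def
    by (rule exI[of _ e1], rule exI[of _ e2], simp add: table_coordinates)+
next
  have "L14 x y = L14 y x" if "L14 (L14 x y - L14 y x) e1 = 0" for x y
    using that by (auto simp: table_coordinates algebra_simps)
  moreover have "L16 x y = L16 y x" if "L16 (L16 x y - L16 y x) e1 = 0" for x y
    using that by (auto simp: table_coordinates algebra_simps)
  moreover have "L24 \<alpha> x y = L24 \<alpha> y x" if "L24 \<alpha> (L24 \<alpha> x y - L24 \<alpha> y x) e1 = 0" for x y
    using that by (auto simp: table_coordinates algebra_simps)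
  moreover have "L30 x y = L30 y x" if "L30 (L30 x y - L30 y x) e1 = 0" for x y
    using that by (simp add: table_coordinates algebra_simps) algebra
  ultimately show "\<not> nonzero_annihilating_commutator L14" "\<not> nonzero_annihilating_commutator L16"
    "\<not> nonzero_annihilating_commutator (L24 \<alpha>)" "\<not> nonzero_annihilating_commutator L30"
    unfolding nonzero_annihilating_commutator_def by blast+
qed

text \<open>In \<open>L14\<close> the vector \<open>e1\<close> anticommutes with everything. In \<open>L16\<close> the symmetric form is
  nondegenerate on \<open>e1\<close> and \<open>e2\<close>, so an anticommuting \<open>x\<close> has no \<open>e1\<close> coordinate and no nonzero
  eigenvalue.\<close>

lemma eigenvalue_one_of_anticommuting_listed:
  "eigenvalue_one_of_anticommuting L14" "\<not> eigenvalue_one_of_anticommuting L16"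
proof -
  show "eigenvalue_one_of_anticommuting L14"
    unfolding eigenvalue_one_of_anticommuting_def
    by (rule exI[of _ e1], rule exI[of _ e3]) (simp add: table_coordinates)
next
  have "y = 0" if "L16 x e1 + L16 e1 x = 0" "L16 x e2 + L16 e2 x = 0" "L16 y x = y" for x y
    using that by (auto simp: table_coordinates algebra_simps)
  then show "\<not> eigenvalue_one_of_anticommuting L16"
    unfolding eigenvalue_one_of_anticommuting_def by blast
qed

text \<open>The symmetric part of the product has rank one in the first three algebras and rank two in the
  others. A form of rank two has two isotropic vectors that are not orthogonal.\<close>

lemma null_vectors_anticommute_listed:
  "null_vectors_anticommute (L24 \<alpha>)" "null_vectors_anticommute L30" "null_vectors_anticommute L36"
  "\<not> null_vectors_anticommute L27" "\<alpha> \<noteq> - 1 \<Longrightarrow> \<not> null_vectors_anticommute (L35 \<alpha>)"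
proof -
  show "\<not> null_vectors_anticommute L27"
    unfolding null_vectors_anticommute_def not_all
    by (rule exI[of _ e1], rule exI[of _ e3]) (simp add: table_coordinates)
  show "\<not> null_vectors_anticommute (L35 \<alpha>)" if "\<alpha> \<noteq> - 1"
    unfolding null_vectors_anticommute_def not_all
    by (rule exI[of _ e1], rule exI[of _ e2])
      (use that in \<open>simp add: table_coordinates add_eq_0_iff2\<close>)
qed (auto simp: null_vectors_anticommute_def table_coordinates)

text \<open>Right multiplication by \<open>e1\<close> is a projection in \<open>L27\<close>. In \<open>L35 \<alpha>\<close> a right multiplication with
  a nonzero eigenvalue maps \<open>e2\<close> to a vector that is not zero but is mapped to zero, and all others
  are nilpotent.\<close>

lemma nonzero_idempotent_multiplication_listed:
  "nonzero_idempotent_multiplication L27" "\<not> nonzero_idempotent_multiplication (L35 \<alpha>)"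
proof -
  have "L27 (L27 y e1) e1 = L27 y e1" "L27 e2 e1 \<noteq> 0" for y by (simp_all add: table_coordinates)
  then show "nonzero_idempotent_multiplication L27"
    unfolding nonzero_idempotent_multiplication_def by blast
next
  have "L35 \<alpha> y x = 0" if "\<And>y. L35 \<alpha> (L35 \<alpha> y x) x = L35 \<alpha> y x" for x y
    using that[of e1] that[of e2] that[of e4] by (auto simp: table_coordinates)
  then show "\<not> nonzero_idempotent_multiplication (L35 \<alpha>)"
    unfolding nonzero_idempotent_multiplication_def by blast
qed

text \<open>Right multiplications in \<open>L24 \<alpha>\<close> are diagonal on the span of \<open>e2\<close> and \<open>e3\<close> and nilpotent
  modulo it. In \<open>L30\<close> right multiplication by \<open>e1\<close> has a Jordan block of size two for the eigenvalue
  one.\<close>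

lemma eigenvalue_one_semisimple_listed:
  "eigenvalue_one_semisimple (L24 \<alpha>)" "\<not> eigenvalue_one_semisimple L30"
proof -
  have "L24 \<alpha> y x = y" if eq: "L24 \<alpha> (L24 \<alpha> y x - y) x = L24 \<alpha> y x - y" for x y
  proof -
    have "y $ 1 = 0" "y $ 4 = 0" "(x $ 1 - 1) * ((x $ 1 - 1) * y $ 2) = 0"
      "(\<alpha> * x $ 1 - 1) * ((\<alpha> * x $ 1 - 1) * y $ 3) = 0"
      using eq by (auto simp: table_coordinates algebra_simps)
    then show ?thesis by (auto simp: table_coordinates mult.commute)
  qed
  then show "eigenvalue_one_semisimple (L24 \<alpha>)" unfolding eigenvalue_one_semisimple_def by blast
next
  show "\<not> eigenvalue_one_semisimple L30"
    unfolding eigenvalue_one_semisimple_def not_all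
    by (rule exI[of _ e1], rule exI[of _ e2]) (simp add: table_coordinates)
qed

lemma entry_of_listed: "m \<in> algebras_of_entry entry \<Longrightarrow> entry_of m = entry"
  by (cases entry)
    (auto simp: entry_of_def products_multiply_to_zero_listed
      square_zero_multiplication_by_nonnull_listed nonzero_annihilating_commutator_listed
      eigenvalue_one_of_anticommuting_listed null_vectors_anticommute_listed
      nonzero_idempotent_multiplication_listed eigenvalue_one_semisimple_listed)

lemma operator_ratio_L35: "operator_ratio (*s) (L35 \<alpha>) \<beta> \<longleftrightarrow> \<alpha> = \<beta>"
proof
  assume "operator_ratio (*s) (L35 \<alpha>) \<beta>"
  then obtain x y where xy: "y \<noteq> 0" "L35 \<alpha> y x = y" and
    eq: "L35 \<alpha> x (L35 \<alpha> x e2) + L35 \<alpha> x e2 = \<beta> *s (L35 \<alpha> e2 x - L35 \<alpha> (L35 \<alpha> e2 x) x)"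
    unfolding operator_ratio_def by blast
  have "x $ 1 \<noteq> 0"
    using xy by (auto simp: table_coordinates)
  then show "\<alpha> = \<beta>" using eq by (auto simp: table_coordinates)
next
  assume "\<alpha> = \<beta>"
  then show "operator_ratio (*s) (L35 \<alpha>) \<beta>"
    unfolding operator_ratio_def
    by (intro exI[of _ e1] conjI exI[of _ e4]) (simp_all add: table_coordinates)
qed

section \<open>Bases and isomorphisms\<close>

definition isomorphic_to_listed ::
  "(complex \<Rightarrow> 'a::ab_group_add \<Rightarrow> 'a) \<Rightarrow> ('a \<Rightarrow> 'a \<Rightarrow> 'a) \<Rightarrow> bool" where
  "isomorphic_to_listed smul mul \<longleftrightarrow>
     (\<exists>entry. \<exists>m\<in>algebras_of_entry entry. algebra_isomorphic smul mul (*s) m)"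

context complex_algebra
begin

notation mul (infixl "\<cdot>" 70)
notation smul (infixr "\<odot>" 75)

lemma mul_add_left: "(x + y) \<cdot> z = x \<cdot> z + y \<cdot> z"
  and mul_add_right: "z \<cdot> (x + y) = z \<cdot> x + z \<cdot> y"
  and mul_scale_left: "(c \<odot> x) \<cdot> z = c \<odot> (x \<cdot> z)"
  and mul_scale_right: "z \<cdot> (c \<odot> x) = c \<odot> (z \<cdot> x)"
  using linear_mul_left[of z] linear_mul_right[of z] by (simp_all add: Vector_Spaces.linear_iff)

lemma mul_zero_left [simp]: "0 \<cdot> z = 0"
  using mul_scale_left[of 0 0 z] by simp

lemma mul_zero_right [simp]: "z \<cdot> 0 = 0"
  using mul_scale_right[of z 0 0] by simp

lemma mul_minus_left: "(- x) \<cdot> z = - (x \<cdot> z)"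
  using mul_add_left[of "- x" x z] by (simp add: eq_neg_iff_add_eq_0)

lemma mul_minus_right: "z \<cdot> (- x) = - (z \<cdot> x)"
  using mul_add_right[of z "- x" x] by (simp add: eq_neg_iff_add_eq_0)

lemma mul_diff_left: "(x - y) \<cdot> z = x \<cdot> z - y \<cdot> z"
  using mul_add_left[of x "- y" z] by (simp add: mul_minus_left)

lemma mul_diff_right: "z \<cdot> (x - y) = z \<cdot> x - z \<cdot> y"
  using mul_add_right[of z x "- y"] by (simp add: mul_minus_right)

lemmas bilinear = mul_add_left mul_add_right mul_scale_left mul_scale_right
  mul_minus_left mul_minus_right mul_diff_left mul_diff_right

lemma mul_sum_left: "(\<Sum>i\<in>I. f i) \<cdot> z = (\<Sum>i\<in>I. f i \<cdot> z)"
  by (induction I rule: infinite_finite_induct) (simp_all add: mul_add_left)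

lemma mul_sum_right: "z \<cdot> (\<Sum>i\<in>I. f i) = (\<Sum>i\<in>I. z \<cdot> f i)"
  by (induction I rule: infinite_finite_induct) (simp_all add: mul_add_right)

lemma self_product_zero: "x \<cdot> x = - (x \<cdot> x) \<Longrightarrow> x \<cdot> x = 0"
proof -
  assume "x \<cdot> x = - (x \<cdot> x)"
  then have "(1 + 1) \<odot> (x \<cdot> x) = 0" unfolding scale_left_distrib by (simp add: eq_neg_iff_add_eq_0)
  then show ?thesis by simp
qed

lemma span_1: "x \<in> span {a} \<longleftrightarrow> (\<exists>s. x = s \<odot> a)"
  by (auto simp: span_singleton)

lemma span_2: "x \<in> span {a, b} \<longleftrightarrow> (\<exists>s t. x = s \<odot> a + t \<odot> b)"
  by (simp add: span_insert[of a] span_1 algebra_simps)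

lemma span_3: "x \<in> span {a, b, c} \<longleftrightarrow> (\<exists>s t u. x = s \<odot> a + t \<odot> b + u \<odot> c)"
  by (simp add: span_insert[of a] span_2 algebra_simps)

lemma span_4: "x \<in> span {a, b, c, d} \<longleftrightarrow> (\<exists>s t u w. x = s \<odot> a + t \<odot> b + u \<odot> c + w \<odot> d)"
  by (simp add: span_insert[of a] span_3 algebra_simps)

lemma in_span_4I: "x = s \<odot> a + t \<odot> b + u \<odot> c + w \<odot> d \<Longrightarrow> x \<in> span {a, b, c, d}"
  using span_4 by blast

lemma span_UNIV_mono:
  assumes "span S = UNIV" and "\<And>x. x \<in> S \<Longrightarrow> x \<in> span T"
  shows "span T = UNIV"
  using assms span_minimal[OF _ subspace_span, of S T] by blast

lemma finite_dimensional_4: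
  assumes "dim UNIV = 4"
  obtains B where "finite_dimensional_vector_space smul B"
proof -
  obtain B where B: "independent B" "UNIV \<subseteq> span B" "card B = dim UNIV"
    by (rule basis_exists[of UNIV])
  then have "finite B" using assms card.infinite by fastforce
  with B show thesis
    by (intro that[of B] finite_dimensional_vector_space.intro)
      (auto simp: vector_space_axioms finite_dimensional_vector_space_axioms_def)
qed

text \<open>Bases are given by spanning quadruples throughout; these are linearly independent because the
  dimension is four. The quadruples come from chains of vectors each of which lies outside the span
  of the later ones.\<close>

lemma independent_quadruple_spans:
  assumes "dim UNIV = 4" and "d \<noteq> 0" and "c \<notin> span {d}" and "b \<notin> span {c, d}"
    and "a \<notin> span {b, c, d}"
  shows "span {a, b, c, d} = UNIV"
proof -
  obtain B where "finite_dimensional_vector_space smul B"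
    using finite_dimensional_4 assms(1) by blast
  then interpret finite_dimensional_vector_space smul B .
  have "dim {a, b, c, d} = 4"
    using assms by (simp add: dim_insert)
  then show ?thesis
    using assms(1) dim_eq_full[of "{a, b, c, d}"] by (simp add: dimension_def)
qed

lemma triple_not_spanning:
  assumes "dim UNIV = 4"
  obtains d where "d \<notin> span {a, b, c}"
proof -
  have "dim (span {a, b, c}) \<le> card {a, b, c}" by (simp add: dim_le_card')
  also have "\<dots> \<le> 3" by (simp add: card_insert_if)
  finally have "dim (span {a, b, c}) \<noteq> dim UNIV" using assms by linarith
  then show thesis using that by (metis UNIV_eq_I)
qed

text \<open>The isomorphism is the inverse of the map that sends coordinates to linear combinations of the
  \<open>b i\<close>. That map is onto because the \<open>b i\<close> span, hence bijective because the dimensions agree.\<close>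

lemma isomorphic_if_structure_constants:
  fixes m :: product4 and b :: "4 \<Rightarrow> 'a"
  assumes dim: "dim UNIV = 4" and span: "span (range b) = UNIV" and m: "complex_algebra (*s) m"
    and b: "\<And>i j. b i \<cdot> b j = (\<Sum>k\<in>UNIV. (m (axis i 1) (axis j 1) $ k) \<odot> b k)"
  shows "algebra_isomorphic smul mul (*s) m"
proof -
  interpret m: complex_algebra "(*s)" m by (rule m)
  define g :: "complex ^ 4 \<Rightarrow> 'a" where "g v = (\<Sum>k\<in>UNIV. (v $ k) \<odot> b k)" for v
  have lin: "Vector_Spaces.linear (*s) smul g"
    unfolding Vector_Spaces.linear_iff
    using vector_space_axioms vec.vector_space_axioms
    by (auto simp: g_def scale_left_distrib sum.distrib scale_sum_right vector_space_assms)
  interpret g: Vector_Spaces.linear "(*s)" smul g by (rule lin)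
  have g_axis: "g (axis i 1) = b i" for i
    by (simp add: g_def axis_def if_distrib[of "\<lambda>c. c \<odot> _"] cong: if_cong)
  have "range b \<subseteq> range g" using g_axis by (metis image_subset_iff rangeI)
  moreover have "subspace (range g)"
    using g.subspace_image[OF vec.subspace_UNIV] .
  ultimately have surj: "surj g" using span span_minimal[of "range b" "range g"] by blast
  obtain B where B: "finite_dimensional_vector_space smul B"
    using finite_dimensional_4 dim by blast
  interpret pair: finite_dimensional_vector_space_pair "(*s) :: complex \<Rightarrow> complex^4 \<Rightarrow> complex^4"
    cart_basis smul B
    using B vec.finite_dimensional_vector_space_axioms
    by (simp add: finite_dimensional_vector_space_pair_def)
  have inj: "inj g"
    by (rule pair.linear_surjective_imp_injective[OF lin surj])
      (simp add: dim dim_complex_4 del: vec.dim_UNIV pair.vs2.dim_UNIV)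
  have g_mul: "g (m x y) = g x \<cdot> g y" for x y
  proof -
    have "m x y = m (\<Sum>i\<in>UNIV. (x $ i) *s axis i 1) (\<Sum>j\<in>UNIV. (y $ j) *s axis j 1)"
      by (simp add: basis_expansion)
    also have "\<dots> = (\<Sum>j\<in>UNIV. \<Sum>i\<in>UNIV. (y $ j * x $ i) *s m (axis i 1) (axis j 1))"
      by (simp add: m.mul_sum_left m.mul_sum_right m.mul_scale_left m.mul_scale_right
        vec.scale_sum_right sum_distrib_left mult.commute mult.left_commute)
    finally have "g (m x y) = (\<Sum>j\<in>UNIV. \<Sum>i\<in>UNIV. (y $ j * x $ i) \<odot> g (m (axis i 1) (axis j 1)))"
      by (simp add: g.sum g.scale)
    also have "\<dots> = (\<Sum>j\<in>UNIV. \<Sum>i\<in>UNIV. (y $ j * x $ i) \<odot> (b i \<cdot> b j))"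
      by (simp add: b g_def)
    also have "\<dots> = g x \<cdot> g y"
      unfolding g_def
      by (simp add: mul_sum_left mul_sum_right mul_scale_left mul_scale_right scale_sum_right
          mult.commute)
    finally show ?thesis .
  qed
  have "bij g" using inj surj by (simp add: bij_betw_def)
  then have "bij (inv g)" by (rule bij_imp_bij_inv)
  moreover have "Vector_Spaces.linear smul (*s) (inv g)"
    unfolding Vector_Spaces.linear_iff
    using vector_space_axioms vec.vector_space_axioms inj surj
    by (metis (no_types, lifting) g.add g.scale inv_f_f surj_f_inv_f)
  moreover have "inv g (x \<cdot> y) = m (inv g x) (inv g y)" for x y
    by (rule injD[OF inj]) (simp add: g_mul surj_f_inv_f[OF surj])
  ultimately show ?thesis unfolding algebra_isomorphic_def by blast
qed

abbreviation listed :: bool where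
  "listed \<equiv> isomorphic_to_listed smul mul"

text \<open>A quadruple as a family over the index type of the tables.\<close>

definition frame :: "'a \<Rightarrow> 'a \<Rightarrow> 'a \<Rightarrow> 'a \<Rightarrow> 4 \<Rightarrow> 'a" where
  "frame a b c d = (\<lambda>i. if i = 1 then a else if i = 2 then b else if i = 3 then c else d)"

lemma frame_simps [simp]:
  "frame a b c d 1 = a" "frame a b c d 2 = b" "frame a b c d 3 = c" "frame a b c d 4 = d"
  by (simp_all add: frame_def)

text \<open>The product formulas are spelled out so that for a concrete table they simplify to the sixteen
  products of the vectors \<open>a\<close>, \<open>b\<close>, \<open>c\<close>, \<open>d\<close>.\<close>

lemma listed_if_structure_constants:
  assumes "m \<in> algebras_of_entry entry" and "dim UNIV = 4" and "span {a, b, c, d} = UNIV"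
    and "\<forall>i j. frame a b c d i \<cdot> frame a b c d j =
      (m (axis i 1) (axis j 1) $ 1) \<odot> a + (m (axis i 1) (axis j 1) $ 2) \<odot> b
      + (m (axis i 1) (axis j 1) $ 3) \<odot> c + (m (axis i 1) (axis j 1) $ 4) \<odot> d"
  shows listed
proof -
  have "range (frame a b c d) = {a, b, c, d}" by (simp add: UNIV_4)
  moreover have "complex_algebra (*s) m"
    using assms(1) algebras_of_entry_satisfy_hypotheses
    unfolding nonnilpotent_nonlie_symmetric_leibniz_4_def symmetric_leibniz_algebra_def by blast
  ultimately show ?thesis
    unfolding isomorphic_to_listed_def
    using assms isomorphic_if_structure_constants[of "frame a b c d" m] by (auto simp: sum_4)
qed

end

section \<open>Annihilating and anticommuting elements\<close>

context symmetric_leibniz_algebra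
begin

definition annihilator :: "'a set" where
  "annihilator = {x. \<forall>y. x \<cdot> y = 0 \<and> y \<cdot> x = 0}"

lemma annihilator_mul: "x \<in> annihilator \<Longrightarrow> x \<cdot> y = 0" "x \<in> annihilator \<Longrightarrow> y \<cdot> x = 0"
  by (simp_all add: annihilator_def)

lemma subspace_annihilator: "subspace annihilator"
  by (rule subspaceI) (auto simp: annihilator_def bilinear)

text \<open>In each Leibniz identity two terms cancel when the two arguments that it permutes are equal.\<close>

lemma square_in_annihilator: "x \<cdot> x \<in> annihilator"
  using left_leibniz[of x x] right_leibniz[of _ x x] by (simp add: annihilator_def)

text \<open>Polarization of the statement on squares.\<close>

lemma anticommutator_in_annihilator: "x \<cdot> y + y \<cdot> x \<in> annihilator"
proof -
  have "(x + y) \<cdot> (x + y) - x \<cdot> x - y \<cdot> y \<in> annihilator"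
    by (intro subspace_diff[OF subspace_annihilator] square_in_annihilator)
  then show ?thesis by (simp add: bilinear algebra_simps)
qed

text \<open>Adding the left identity for \<open>z(xy)\<close> to the right identity for \<open>(xy)z\<close>, the terms on the right
  cancel in pairs, because factors can be exchanged inside a product at the cost of a sign.\<close>

lemma product_anticommutes: "z \<cdot> (x \<cdot> y) = - ((x \<cdot> y) \<cdot> z)"
proof -
  have 1: "(z \<cdot> x) \<cdot> y = - ((x \<cdot> z) \<cdot> y)"  "x \<cdot> (z \<cdot> y) = - (x \<cdot> (y \<cdot> z))"
    using annihilator_mul[OF anticommutator_in_annihilator]
      by (simp_all add: bilinear eq_neg_iff_add_eq_0  flip: mul_add_left mul_add_right)
  have "z \<cdot> (x \<cdot> y) + (x \<cdot> y) \<cdot> z = 0"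
    using left_leibniz[of z x y] right_leibniz[of x y z] 1 by simp
  then show ?thesis by (simp add: eq_neg_iff_add_eq_0)
qed

lemma product_square_zero: "(x \<cdot> y) \<cdot> (x \<cdot> y) = 0"
  by (rule self_product_zero) (rule product_anticommutes)

text \<open>One of the two factors of a product of at least four elements is itself a product, so that the
  whole product is annihilating up to sign; one of the two factors of a product of eight elements
  has at least four.\<close>

lemma nilpotent_if_triple_products_annihilate:
  assumes "\<And>x y z. (x \<cdot> y) \<cdot> z \<in> annihilator"
  shows "nilpotent_algebra mul"
proof -
  have 1: "\<exists>u v. x = u \<cdot> v" if "is_product mul k x" "k \<ge> 2" for k x
    using that by cases auto
  have 2: "x \<in> annihilator" if "is_product mul k x" "k \<ge> 4" for k x
    using that(1)
  proof cases
    case prod: (2 i u j v)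
    then have "i \<ge> 2 \<or> j \<ge> 2" using \<open>k \<ge> 4\<close> by linarith
    then show ?thesis
      using 1[OF prod(3)] 1[OF prod(4)] prod(2) assms product_anticommutes subspace_neg[OF subspace_annihilator] by metis
  qed (use that in simp)
  have "x = 0" if "is_product mul 8 x" for x
    using that
  proof cases
    case prod: (2 i u j v)
    then have "i \<ge> 4 \<or> j \<ge> 4" by linarith
    then show ?thesis
      using prod(2) 2[OF prod(3)] 2[OF prod(4)] annihilator_mul by metis
  qed simp
  then show ?thesis unfolding nilpotent_algebra_def by (intro exI[of _ 8]) simp
qed

end

section \<open>Algebras given by a bilinear form on two basis vectors\<close>

locale symmetric_leibniz_algebra_4 = symmetric_leibniz_algebra +
  assumes dim_4: "dim UNIV = 4"
begin

text \<open>The matrix \<open>(A B; C D)\<close> is that of the product of \<open>x\<close> and \<open>z\<close>, seen as a bilinear form with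
  values in the line of \<open>e\<close>. The only other nonzero products are those of \<open>x\<close> with \<open>r\<close>.\<close>

definition form_basis :: "complex \<Rightarrow> complex \<Rightarrow> complex \<Rightarrow> complex \<Rightarrow> 'a \<Rightarrow> 'a \<Rightarrow> 'a \<Rightarrow> 'a \<Rightarrow> bool" where
  "form_basis A B C D x z r e \<longleftrightarrow>
     span {x, z, r, e} = UNIV \<and> e \<in> annihilator \<and>
     x \<cdot> r = - r \<and> r \<cdot> x = r \<and> z \<cdot> r = 0 \<and> r \<cdot> z = 0 \<and> r \<cdot> r = 0 \<and>
     x \<cdot> x = A \<odot> e \<and> x \<cdot> z = B \<odot> e \<and> z \<cdot> x = C \<odot> e \<and> z \<cdot> z = D \<odot> e"

text \<open>These substitutions keep the products with \<open>r\<close>; the coefficient of \<open>x\<close> cannot be changed, as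
  the eigenvalue of \<open>x\<close> on \<open>r\<close> is fixed.\<close>

lemma form_basis_change:
  assumes "form_basis A B C D x z r e" and "s \<noteq> 0" and "w \<noteq> 0"
  shows "form_basis ((A + t * (B + C) + t\<^sup>2 * D) / w) (s * (B + t * D) / w) (s * (C + t * D) / w)
    (s\<^sup>2 * D / w) (x + t \<odot> z) (s \<odot> z) r (w \<odot> e)"
proof -
  have "span {x + t \<odot> z, s \<odot> z, r, w \<odot> e} = UNIV"
  proof (rule span_UNIV_mono[of "{x, z, r, e}"])
    let ?S = "span {x + t \<odot> z, s \<odot> z, r, w \<odot> e}"
    have "x \<in> ?S" by (rule in_span_4I[of _ 1 _ "- t / s" _ 0 _ 0]) (use assms in simp)
    moreover have "z \<in> ?S" by (rule in_span_4I[of _ 0 _ "1 / s" _ 0 _ 0]) (use assms in simp)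
    moreover have "e \<in> ?S" by (rule in_span_4I[of _ 0 _ 0 _ 0 _ "1 / w"]) (use assms in simp)
    ultimately show "y \<in> ?S" if "y \<in> {x, z, r, e}" for y
      using that by (auto intro: span_base)
  qed (use assms in \<open>simp add: form_basis_def\<close>)
  moreover have "w \<odot> e \<in> annihilator"
    using assms subspace_scale[OF subspace_annihilator] by (simp add: form_basis_def)
  ultimately show ?thesis
    using assms
    by (simp add: form_basis_def bilinear power2_eq_square algebra_simps add_divide_distrib)
qed

lemma listed_L14:
  assumes "form_basis 0 0 0 1 x z r e"
  shows listed
proof (rule listed_if_structure_constants[of "L14" Entry14, OF _ dim_4])
  show "L14 \<in> algebras_of_entry Entry14" using assms by auto
next
  show "span {x, z, r, e} = UNIV"
    using assms by (simp add: form_basis_def insert_commute)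
qed (use assms in \<open>simp_all add: form_basis_def annihilator_mul table_coordinates\<close>)

lemma listed_L15:
  assumes "form_basis \<alpha> 1 0 1 x z r e"
  shows listed
proof (rule listed_if_structure_constants[of "L15 \<alpha>" Entry15, OF _ dim_4])
  show "L15 \<alpha> \<in> algebras_of_entry Entry15" using assms by auto
next
  show "span {x, z, r, e} = UNIV"
    using assms by (simp add: form_basis_def insert_commute)
qed (use assms in \<open>simp_all add: form_basis_def annihilator_mul table_coordinates\<close>)

lemma listed_L16:
  assumes "form_basis (- 2) 0 0 1 x z r e"
  shows listed
proof (rule listed_if_structure_constants[of "L16" Entry16, OF _ dim_4])
  show "L16 \<in> algebras_of_entry Entry16" using assms by auto
next
  show "span {x, z, r, e} = UNIV"
    using assms by (simp add: form_basis_def insert_commute)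
qed (use assms in \<open>simp_all add: form_basis_def annihilator_mul table_coordinates\<close>)

lemma listed_L24:
  assumes "form_basis 1 0 0 0 x z r e"
  shows listed
proof (rule listed_if_structure_constants[of "L24 0" Entry24, OF _ dim_4])
  show "L24 0 \<in> algebras_of_entry Entry24" using assms by auto
next
  show "span {x, r, z, e} = UNIV"
    using assms by (simp add: form_basis_def insert_commute)
qed (use assms in \<open>simp_all add: form_basis_def annihilator_mul table_coordinates\<close>)

lemma listed_L27:
  assumes "form_basis 0 1 0 0 x z r e"
  shows listed
proof (rule listed_if_structure_constants[of "L27" Entry27, OF _ dim_4])
  show "L27 \<in> algebras_of_entry Entry27" using assms by auto
next
  show "span {x, r, z, e} = UNIV"
    using assms by (simp add: form_basis_def insert_commute)
qed (use assms in \<open>simp_all add: form_basis_def annihilator_mul table_coordinates\<close>)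

lemma listed_L35:
  assumes "form_basis 0 \<alpha> 1 0 x z r e" and "\<alpha> \<noteq> - 1"
  shows listed
proof (rule listed_if_structure_constants[of "L35 \<alpha>" Entry35, OF _ dim_4])
  show "L35 \<alpha> \<in> algebras_of_entry Entry35" using assms by auto
next
  show "span {x, z, e, r} = UNIV"
    using assms by (simp add: form_basis_def insert_commute)
qed (use assms in \<open>simp_all add: form_basis_def annihilator_mul table_coordinates\<close>)

lemma listed_L36:
  assumes "form_basis 1 (- 1) 1 0 x z r e"
  shows listed
proof (rule listed_if_structure_constants[of "L36" Entry36, OF _ dim_4])
  show "L36 \<in> algebras_of_entry Entry36" using assms by auto
next
  show "span {x, z, e, r} = UNIV"
    using assms by (simp add: form_basis_def insert_commute)
qed (use assms in \<open>simp_all add: form_basis_def annihilator_mul table_coordinates\<close>)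

lemma form_basis_alternating:
  assumes "form_basis 0 B (- B) 0 x z r e"
  shows "alternating mul"
  unfolding alternating_def
proof
  fix y
  obtain s t u w where "y = s \<odot> x + t \<odot> z + u \<odot> r + w \<odot> e"
    using span_4[of y x z r e] assms by (auto simp: form_basis_def)
  then show "y \<cdot> y = 0"
    using assms by (simp add: form_basis_def bilinear annihilator_mul algebra_simps)
qed

text \<open>If \<open>D \<noteq> 0\<close>, then \<open>t\<close> can be chosen such that the new \<open>zx\<close> is zero; if the form is not
  symmetric, \<open>s\<close> and \<open>w\<close> then make \<open>xz\<close> and \<open>zz\<close> equal to \<open>e\<close>, and the coefficient of \<open>xx\<close> that is
  left over is the parameter of \<open>L15\<close>; if it is symmetric, it is now diagonal and only its rank
  matters. If \<open>D = 0\<close> and \<open>B + C \<noteq> 0\<close>, then \<open>t\<close> can be chosen such that \<open>xx\<close> becomes zero, and the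
  ratio of \<open>B\<close> to \<open>C\<close> is the parameter of \<open>L35\<close>, the ratio with \<open>C = 0\<close> being \<open>L27\<close>. If \<open>D = 0\<close> and
  \<open>B + C = 0\<close>, then only \<open>xx\<close> can keep the algebra from being a Lie algebra.\<close>

lemma listed_if_form_basis:
  assumes basis: "form_basis A B C D x z r e" and "\<not> alternating mul"
  shows listed
proof (cases "D = 0")
  case False
  define t where "t = - C / D"
  show ?thesis
  proof (cases "B = C")
    case False
    define s where "s = (B - C) / D"
    have "s \<noteq> 0" using False \<open>D \<noteq> 0\<close> by (simp add: s_def)
    have "B + t * D = s * D" "C + t * D = 0"
      using \<open>D \<noteq> 0\<close> by (simp_all add: t_def s_def)
    then have 1: "s * (B + t * D) / (s\<^sup>2 * D) = 1" "s * (C + t * D) / (s\<^sup>2 * D) = 0"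
      using \<open>s \<noteq> 0\<close> \<open>D \<noteq> 0\<close> by (simp_all add: power2_eq_square)
    show ?thesis
      using form_basis_change[OF basis \<open>s \<noteq> 0\<close>, of "s\<^sup>2 * D" t] \<open>s \<noteq> 0\<close> \<open>D \<noteq> 0\<close>
      unfolding 1 by (intro listed_L15) simp
  next
    case True
    define A' where "A' = A + t * (B + C) + t\<^sup>2 * D"
    have 1: "C + t * D = 0" using \<open>D \<noteq> 0\<close> by (simp add: t_def)
    show ?thesis
    proof (cases "A' = 0")
      case True
      show ?thesis
        using form_basis_change[OF basis, of 1 D t, folded A'_def] \<open>D \<noteq> 0\<close>
        by (intro listed_L14) (simp add: \<open>B = C\<close> 1 True)
    next
      case False
      \<comment> \<open>The value \<open>-2\<close> of \<open>xx\<close> in \<open>L16\<close> is reached by a square root.\<close>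
      define s where "s = csqrt (- A' / (2 * D))"
      have s2: "s\<^sup>2 = - A' / (2 * D)" by (simp add: s_def)
      then have s: "s \<noteq> 0" using False \<open>D \<noteq> 0\<close> by auto
      have 2: "A' / (s\<^sup>2 * D) = - 2" using False \<open>D \<noteq> 0\<close> by (simp add: s2)
      show ?thesis
        using form_basis_change[OF basis s, of "s\<^sup>2 * D" t, folded A'_def] s \<open>D \<noteq> 0\<close> 1 2
        by (intro listed_L16) (simp add: \<open>B = C\<close>)
    qed
  qed
next
  case D: True
  show ?thesis
  proof (cases "B + C = 0")
    case False
    define t where "t = - A / (B + C)"
    have t: "A + t * (B + C) = 0" using False by (simp add: t_def)
    show ?thesis
    proof (cases "C = 0")
      case True
      then show ?thesis
        using form_basis_change[OF basis, of 1 B t] False t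
        by (intro listed_L27) (simp add: D)
    next
      case C: False
      have "B / C \<noteq> - 1" using False C by (simp add: field_simps add_eq_0_iff2)
      then show ?thesis
        using form_basis_change[OF basis, of 1 C t] C t
        by (intro listed_L35[of "B / C"]) (simp_all add: D)
    qed
  next
    case True
    then have C: "C = - B" by (simp add: add_eq_0_iff)
    have A: "A \<noteq> 0" using form_basis_alternating basis assms(2) C D by blast
    show ?thesis
    proof (cases "B = 0")
      case True
      then show ?thesis
        using form_basis_change[OF basis, of 1 A 0] A
        by (intro listed_L24) (simp add: D C)
    next
      case False
      then show ?thesis
        using form_basis_change[OF basis, of "- A / B" A 0] A
        by (intro listed_L36) (simp add: D C)
    qed
  qed
qed

text \<open>Adding multiples of \<open>x\<close> and \<open>r\<close> to \<open>z\<close> removes the \<open>r\<close> components of \<open>zr\<close> and \<open>xz\<close>. The \<open>e\<close>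
  component of \<open>zr\<close> then vanishes by the left Leibniz identity for \<open>x(zr)\<close>, because \<open>x\<close> acts on \<open>r\<close>
  with a nonzero eigenvalue and on \<open>e\<close> with eigenvalue zero. Being the product \<open>x(- r)\<close>, the vector
  \<open>r\<close> anticommutes with everything.\<close>

lemma form_basis_if_eigenvector:
  assumes e: "e \<in> annihilator" and UNIV: "span {x, z, r, e} = UNIV" and xr: "x \<cdot> r = - r"
    and zr: "z \<cdot> r \<in> span {r, e}" and xz: "x \<cdot> z \<in> span {r, e}"
    and sym: "x \<cdot> x \<in> span {e}" "z \<cdot> z \<in> span {e}" "x \<cdot> z + z \<cdot> x \<in> span {e}"
  obtains A B C D z' where "form_basis A B C D x z' r e"
proof -
  have r: "r = x \<cdot> (- r)" using xr by (simp add: mul_minus_right)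
  have anti: "r \<cdot> y = - (y \<cdot> r)" for y
    using product_anticommutes[of y x "- r"] r by (metis minus_minus)
  have rr: "r \<cdot> r = 0" using product_square_zero[of x "- r"] r by simp
  obtain s t where st: "z \<cdot> r = s \<odot> r + t \<odot> e" using zr by (auto simp: span_2)
  define z1 where "z1 = z + s \<odot> x"
  obtain A E F where AEF: "x \<cdot> x = A \<odot> e" "z \<cdot> z = E \<odot> e" "x \<cdot> z + z \<cdot> x = F \<odot> e"
    using sym by (auto simp: span_1)
  obtain n k where nk: "x \<cdot> z = n \<odot> r + k \<odot> e" using xz by (auto simp: span_2)
  have zx: "z \<cdot> x = F \<odot> e - n \<odot> r - k \<odot> e" using AEF(3) nk by (simp add: algebra_simps)
  have "x \<cdot> (z1 \<cdot> r) = (x \<cdot> z1) \<cdot> r + z1 \<cdot> (x \<cdot> r)" by (rule left_leibniz)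
  moreover have "z1 \<cdot> r = t \<odot> e" "x \<cdot> z1 = n \<odot> r + (k + s * A) \<odot> e"
    using st xr AEF nk by (simp_all add: z1_def bilinear algebra_simps)
  ultimately have z1r: "t \<odot> e = 0"
    using xr rr annihilator_mul[OF e] by (simp add: bilinear)
  define z' where "z' = z1 + n \<odot> r"
  have "span {x, z', r, e} = UNIV"
  proof (rule span_UNIV_mono[OF UNIV])
    have "z \<in> span {x, z', r, e}"
      by (rule in_span_4I[of _ "- s" _ 1 _ "- n" _ 0]) (simp add: z'_def z1_def)
    then show "y \<in> span {x, z', r, e}" if "y \<in> {x, z, r, e}" for y
      using that by (auto intro: span_base)
  qed
  then have "form_basis A (k + s * A) (F - k + s * A) (E + s * F + s * s * A) x z' r e"
    using AEF(1,2) st nk zx rr e anti[of x] anti[of z] z1r xr annihilator_mul[OF e]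
    by (simp add: form_basis_def z'_def z1_def bilinear scale_left_distrib scale_right_distrib
        scale_left_diff_distrib scale_right_diff_distrib) (simp add: algebra_simps)
  then show thesis using that by blast
qed

lemma listed_if_eigenvector:
  assumes "\<not> alternating mul" and "e \<in> annihilator" and "span {x, z, r, e} = UNIV" and "x \<cdot> r = - r"
    and "z \<cdot> r \<in> span {r, e}" and "x \<cdot> z \<in> span {r, e}"
    and "x \<cdot> x \<in> span {e}" and "z \<cdot> z \<in> span {e}" and "x \<cdot> z + z \<cdot> x \<in> span {e}"
  shows listed
  using assms form_basis_if_eigenvector[of e x z r] listed_if_form_basis by metis

lemma span_annihilator: "S \<subseteq> annihilator \<Longrightarrow> span S \<subseteq> annihilator"
  using span_minimal subspace_annihilator by blast

section \<open>Annihilators that contain more than a square\<close>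

text \<open>Let \<open>b\<close> complete \<open>a\<close>, \<open>v\<close> and \<open>aa\<close> to a basis. Modulo the annihilator all products are
  multiples of \<open>ab\<close>, so \<open>ab\<close> is not annihilating. Then \<open>ab\<close> has a nonzero \<open>b\<close> component \<open>s\<close>, since
  it anticommutes with \<open>a\<close> while \<open>aa \<noteq> 0\<close>, and up to \<open>aa\<close> it is an eigenvector of \<open>a\<close> with
  eigenvalue \<open>s\<close>.\<close>

lemma listed_if_large_annihilator:
  assumes not_nil: "\<not> nilpotent_algebra mul" and not_alt: "\<not> alternating mul"
    and a: "a \<cdot> a \<noteq> 0" and v: "v \<in> annihilator" "v \<notin> span {a \<cdot> a}"
  shows listed
proof -
  define e where "e = a \<cdot> a"
  have aa: "a \<cdot> a = e" and "e \<noteq> 0" using a by (simp_all add: e_def)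
  have e: "e \<in> annihilator" by (simp add: e_def square_in_annihilator)
  note zero [simp] = annihilator_mul[OF e] annihilator_mul[OF v(1)]
  have "span {v, e} \<subseteq> annihilator" using v e by (intro span_annihilator) simp
  then have "a \<notin> span {v, e}" using a annihilator_mul by blast
  moreover obtain b where "b \<notin> span {a, v, e}" using triple_not_spanning[OF dim_4] by blast
  ultimately have UNIV: "span {b, a, v, e} = UNIV"
    using v(2) \<open>e \<noteq> 0\<close> by (intro independent_quadruple_spans[OF dim_4]) (simp_all add: e_def)
  define p where "p = a \<cdot> b"
  have p_not: "p \<notin> annihilator"
  proof
    assume p: "p \<in> annihilator"
    have ba: "b \<cdot> a \<in> annihilator"
      using subspace_diff[OF subspace_annihilator anticommutator_in_annihilator[of a b] p]
        by (simp add: p_def)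
    have "y \<cdot> z \<in> annihilator" for y z
    proof -
      obtain s t u w where y: "y = s \<odot> b + t \<odot> a + u \<odot> v + w \<odot> e" using UNIV span_4 by blast
      obtain s' t' u' w' where z: "z = s' \<odot> b + t' \<odot> a + u' \<odot> v + w' \<odot> e" using UNIV span_4 by blast
      have "y \<cdot> z = (s * s') \<odot> (b \<cdot> b) + (s * t') \<odot> (b \<cdot> a) + (t * s') \<odot> p + (t * t') \<odot> e"
        unfolding y z by (simp add: bilinear p_def aa algebra_simps)
      then show ?thesis
        using p ba e square_in_annihilator[of b] subspace_annihilator
        by (simp add: subspace_add subspace_scale)
    qed
    then show False
      using not_nil nilpotent_if_triple_products_annihilate by blast
  qed
  obtain s t u w where p_eq: "p = s \<odot> b + t \<odot> a + u \<odot> v + w \<odot> e" using UNIV span_4 by blast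
  have ap: "a \<cdot> p = s \<odot> p + t \<odot> e"
    by (subst p_eq) (simp add: bilinear p_def aa)
  have "s \<noteq> 0"
  proof
    assume "s = 0"
    then have "p \<cdot> a = t \<odot> e" "a \<cdot> p = t \<odot> e" using p_eq ap by (simp_all add: bilinear aa)
    moreover have "a \<cdot> p = - (p \<cdot> a)" unfolding p_def by (rule product_anticommutes)
    ultimately have "t \<odot> e = - (t \<odot> e)" by simp
    then have "(t + t) \<odot> e = 0" by (metis add.left_inverse scale_left_distrib)
    then have "t = 0" using \<open>e \<noteq> 0\<close> by simp
    then have "p \<in> annihilator"
      using p_eq \<open>s = 0\<close> e v subspace_annihilator by (simp add: subspace_add subspace_scale)
    with p_not show False by simp
  qed
  define x where "x = (- 1 / s) \<odot> a"
  define r where "r = p + (t / s) \<odot> e"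
  have "span {x, v, r, e} = UNIV"
  proof (rule span_UNIV_mono[OF UNIV])
    have "a \<in> span {x, v, r, e}"
      by (rule in_span_4I[of _ "- s" _ 0 _ 0 _ 0]) (use \<open>s \<noteq> 0\<close> in \<open>simp add: x_def\<close>)
    moreover have "b \<in> span {x, v, r, e}"
      by (rule in_span_4I[of _ t _ "- u / s" _ "1 / s" _ "- t / s\<^sup>2 - w / s"])
        (use \<open>s \<noteq> 0\<close> in \<open>simp add: x_def r_def p_eq power2_eq_square algebra_simps\<close>)
    ultimately show "y \<in> span {x, v, r, e}" if "y \<in> {b, a, v, e}" for y
      using that by (auto intro: span_base)
  qed
  moreover have "x \<cdot> r = - r" using \<open>s \<noteq> 0\<close> ap by (simp add: x_def r_def bilinear algebra_simps)
  moreover have "x \<cdot> x \<in> span {e}" by (simp add: x_def bilinear aa span_scale span_base)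
  ultimately show listed
    by (intro listed_if_eigenvector[OF not_alt e, of x v r]) (simp_all add: span_zero)
qed

section \<open>The radical of the symmetric form\<close>

definition radical :: "'a set" where
  "radical = {x. \<forall>y. x \<cdot> y + y \<cdot> x = 0}"

lemma subspace_radical: "subspace radical"
proof (rule subspaceI)
  fix c x y assume "x \<in> radical" "y \<in> radical"
  then have *: "z \<cdot> x = - (x \<cdot> z)" "z \<cdot> y = - (y \<cdot> z)" for z
    by (simp_all add: radical_def add_eq_0_iff)
  then show "x + y \<in> radical" "c \<odot> x \<in> radical"
    by (simp_all add: radical_def bilinear)
qed (simp add: radical_def)

lemma radical_anticommutes: "x \<in> radical \<Longrightarrow> y \<cdot> x = - (x \<cdot> y)"
  by (simp add: radical_def add_eq_0_iff)

lemma product_in_radical: "x \<cdot> y \<in> radical"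
  using product_anticommutes by (simp add: radical_def)

lemma annihilator_in_radical: "annihilator \<subseteq> radical"
  by (auto simp: radical_def annihilator_def)

lemma radical_square_zero: "x \<in> radical \<Longrightarrow> x \<cdot> x = 0"
  using self_product_zero radical_anticommutes by blast

text \<open>As products lie in the radical, every left multiplication maps \<open>p\<close> into the span of \<open>p\<close> and
  \<open>e\<close>. If all of them mapped \<open>p\<close> into the line of \<open>e\<close>, then triple products would be annihilating;
  otherwise one of the basis vectors has a nonzero eigenvalue on \<open>p\<close> modulo \<open>e\<close>.\<close>

lemma listed_if_small_radical:
  assumes not_nil: "\<not> nilpotent_algebra mul" and not_alt: "\<not> alternating mul"
    and a: "a \<cdot> a \<noteq> 0" and ann: "annihilator = span {e}" and "e \<noteq> 0"
    and p: "p \<in> radical" "p \<notin> span {e}" and rad: "radical \<subseteq> span {p, e}"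
  shows listed
proof -
  have e: "e \<in> annihilator" by (simp add: ann span_base)
  note zero [simp] = annihilator_mul[OF e]
  have sub: "span {p, e} \<subseteq> radical"
    using p e annihilator_in_radical subspace_radical by (intro span_minimal) auto
  have "a \<notin> span {p, e}" using a sub radical_square_zero by blast
  moreover obtain b where "b \<notin> span {a, p, e}" using triple_not_spanning[OF dim_4] by blast
  ultimately have UNIV: "span {b, a, p, e} = UNIV"
    using p \<open>e \<noteq> 0\<close> by (intro independent_quadruple_spans[OF dim_4]) simp_all
  \<comment> \<open>\<open>x\<close> is \<open>a\<close> or \<open>b\<close>, and \<open>z\<close> the other one.\<close>
  have "\<exists>x z. span {x, z, p, e} = UNIV \<and> x \<cdot> p \<notin> span {e}"
  proof (rule ccontr)
    assume "\<not> ?thesis"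
    moreover have "span {a, b, p, e} = UNIV" using UNIV by (simp add: insert_commute)
    ultimately have ap: "a \<cdot> p \<in> span {e}" "b \<cdot> p \<in> span {e}" using UNIV by blast+
    have yp: "y \<cdot> p \<in> span {e}" for y
    proof -
      obtain s t u w where y: "y = s \<odot> b + t \<odot> a + u \<odot> p + w \<odot> e" using UNIV span_4 by blast
      have "y \<cdot> p = s \<odot> (b \<cdot> p) + t \<odot> (a \<cdot> p)"
        unfolding y by (simp add: bilinear radical_square_zero[OF p(1)])
      then show ?thesis using ap by (simp add: span_add span_scale)
    qed
    have "(x \<cdot> y) \<cdot> z \<in> annihilator" for x y z
    proof -
      obtain c d where "x \<cdot> y = c \<odot> p + d \<odot> e" using product_in_radical rad span_2 by blast
      then have "(x \<cdot> y) \<cdot> z = (- c) \<odot> (z \<cdot> p)"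
        using radical_anticommutes[OF p(1), of z] by (simp add: bilinear)
      then show ?thesis using yp[of z] by (simp only: ann span_scale)
    qed
    then show False using not_nil nilpotent_if_triple_products_annihilate by blast
  qed
  then obtain x z where UNIV: "span {x, z, p, e} = UNIV" and xp: "x \<cdot> p \<notin> span {e}" by blast
  have prod: "y \<cdot> y' \<in> span {p, e}" for y y' using product_in_radical rad by blast
  obtain l m where lm: "x \<cdot> p = l \<odot> p + m \<odot> e" using prod span_2 by blast
  have "l \<noteq> 0" using lm xp by (auto simp: span_1)
  define x' where "x' = (- 1 / l) \<odot> x"
  define r where "r = p + (m / l) \<odot> e"
  have span_r: "span {p, e} = span {r, e}"
  proof -
    have "p \<in> span {r, e}" unfolding span_2
      by (intro exI[of _ 1] exI[of _ "- m / l"]) (simp add: r_def)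
    moreover have "r \<in> span {p, e}" unfolding span_2
      by (intro exI[of _ 1] exI[of _ "m / l"]) (simp add: r_def)
    ultimately show ?thesis by (auto simp: span_eq span_base)
  qed
  have "span {x', z, r, e} = UNIV"
  proof (rule span_UNIV_mono[OF UNIV])
    have "x \<in> span {x', z, r, e}"
      by (rule in_span_4I[of _ "- l" _ 0 _ 0 _ 0]) (use \<open>l \<noteq> 0\<close> in \<open>simp add: x'_def\<close>)
    moreover have "p \<in> span {x', z, r, e}"
      by (rule in_span_4I[of _ 0 _ 0 _ 1 _ "- m / l"]) (simp add: r_def)
    ultimately show "y \<in> span {x', z, r, e}" if "y \<in> {x, z, p, e}" for y
      using that by (auto intro: span_base)
  qed
  moreover have "x' \<cdot> r = - r" using \<open>l \<noteq> 0\<close> lm by (simp add: x'_def r_def bilinear algebra_simps)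
  ultimately show listed
    using square_in_annihilator anticommutator_in_annihilator prod
    by (intro listed_if_eigenvector[OF not_alt e, of x' z r]) (simp_all add: ann span_r)
qed

text \<open>The products of elements of the radical form the line spanned by \<open>r = pq\<close>, on which a multiple
  \<open>x\<close> of \<open>p\<close> (or of \<open>q\<close>) acts by \<open>-1\<close>. Left multiplication by \<open>a\<close> is a derivation of the radical, so
  it preserves this line, and comparing \<open>a(xr)\<close> with \<open>- ar\<close> shows that it maps \<open>x\<close> into the span of
  \<open>r\<close> and \<open>e\<close>. Thus \<open>a\<close> can take the place of the vector \<open>z\<close> in \<open>listed_if_eigenvector\<close>.\<close>

lemma listed_if_radical_nonabelian:
  assumes not_alt: "\<not> alternating mul" and ann: "annihilator = span {e}" and "e \<noteq> 0"
    and UNIV: "span {a, q, p, e} = UNIV" and rad: "radical = span {q, p, e}"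
    and pq: "p \<cdot> q \<notin> span {e}"
  shows listed
proof -
  have e: "e \<in> annihilator" by (simp add: ann span_base)
  note zero [simp] = annihilator_mul[OF e]
  have main: listed
    if UNIV: "span {a, q, p, e} = UNIV" and rad: "radical = span {q, p, e}"
    and pq: "p \<cdot> q \<notin> span {e}"
      and eq: "p \<cdot> q = u \<odot> p + v \<odot> q + w \<odot> e" and "v \<noteq> 0" for p q u v w
  proof -
    define r where "r = p \<cdot> q"
    define x where "x = (- 1 / v) \<odot> p"
    have p: "p \<in> radical" and q: "q \<in> radical" by (simp_all add: rad span_base)
    have pp: "p \<cdot> p = 0" and qq: "q \<cdot> q = 0" and qp: "q \<cdot> p = - r"
      unfolding r_def using p q radical_square_zero radical_anticommutes by blast+
    have pr: "p \<cdot> r = v \<odot> r" and qr: "q \<cdot> r = (- u) \<odot> r"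
      unfolding r_def eq by (simp_all add: bilinear pp qq qp r_def eq algebra_simps)
    have xr: "x \<cdot> r = - r" using pr \<open>v \<noteq> 0\<close> by (simp add: x_def bilinear)
    have prod: "y \<cdot> y' \<in> span {r}" if y: "y \<in> radical" "y' \<in> radical" for y y'
    proof -
      obtain s t c where "y = s \<odot> q + t \<odot> p + c \<odot> e" using y(1) by (auto simp: rad span_3)
      moreover obtain s' t' c' where "y' = s' \<odot> q + t' \<odot> p + c' \<odot> e"
        using y(2) by (auto simp: rad span_3)
      ultimately have "y \<cdot> y' = (t * s' - s * t') \<odot> r"
        by (simp add: bilinear pp qq qp scale_left_diff_distrib mult.commute flip: r_def)
      then show ?thesis by (simp add: span_base span_scale)
    qed
    have "a \<cdot> r = (a \<cdot> p) \<cdot> q + p \<cdot> (a \<cdot> q)" unfolding r_def by (rule left_leibniz)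
    then have "a \<cdot> r \<in> span {r}" using p q product_in_radical prod by (simp add: span_add)
    then obtain l where ar: "a \<cdot> r = l \<odot> r" by (auto simp: span_1)
    obtain s t c where ax: "a \<cdot> x = s \<odot> q + t \<odot> p + c \<odot> e"
      using product_in_radical[of a x] by (auto simp: rad span_3)
    have "a \<cdot> (x \<cdot> r) = (a \<cdot> x) \<cdot> r + x \<cdot> (a \<cdot> r)" by (rule left_leibniz)
    then have "(a \<cdot> x) \<cdot> r = 0" by (simp add: xr ar bilinear)
    then have "(t * v - s * u) \<odot> r = 0" by (simp add: ax bilinear pr qr scale_left_diff_distrib)
    moreover have "r \<noteq> 0" using pq span_zero[of "{e}"] by (auto simp: r_def)
    ultimately have "t = s * u / v" using \<open>v \<noteq> 0\<close> by (simp add: field_simps)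
    then have "a \<cdot> x = (s / v) \<odot> r + (c - s * w / v) \<odot> e"
      using \<open>v \<noteq> 0\<close> by (simp add: ax r_def eq algebra_simps)
    then have "a \<cdot> x \<in> span {r, e}" using span_2 by blast
    moreover have "x \<cdot> a = - (a \<cdot> x)"
      using p by (simp add: radical_anticommutes[of p a] x_def bilinear)
    ultimately have xa: "x \<cdot> a \<in> span {r, e}" by (simp add: span_neg)
    have "span {x, a, r, e} = UNIV"
    proof (rule span_UNIV_mono[OF UNIV])
      have "p \<in> span {x, a, r, e}"
        by (rule in_span_4I[of _ "- v" _ 0 _ 0 _ 0]) (use \<open>v \<noteq> 0\<close> in \<open>simp add: x_def\<close>)
      moreover have "q \<in> span {x, a, r, e}"
        by (rule in_span_4I[of _ u _ 0 _ "1 / v" _ "- w / v"])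
          (use \<open>v \<noteq> 0\<close> in \<open>simp add: x_def r_def eq algebra_simps\<close>)
      ultimately show "y \<in> span {x, a, r, e}" if "y \<in> {a, q, p, e}" for y
        using that by (auto intro: span_base)
    qed
    then show listed
      using xr xa ar square_in_annihilator anticommutator_in_annihilator
      by (intro listed_if_eigenvector[OF not_alt e, of x a r]) (auto simp: ann span_base span_scale)
  qed
  obtain v u w where eq: "p \<cdot> q = v \<odot> q + u \<odot> p + w \<odot> e"
    using product_in_radical[of p q] by (auto simp: rad span_3)
  show listed
  proof (cases "v = 0")
    case False
    then show ?thesis using main[OF UNIV rad pq, of u v w] eq by (simp add: add.commute)
  next
    case True
    have "q \<cdot> p = - (p \<cdot> q)" using radical_anticommutes[of p q] by (simp add: rad span_base)
    moreover from this have "q \<cdot> p \<notin> span {e}" using pq by (metis minus_minus span_neg)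
    moreover from calculation have "q \<cdot> p = 0 \<odot> q + (- u) \<odot> p + (- w) \<odot> e"
      using eq True by simp
    moreover have "u \<noteq> 0" using eq True pq by (auto simp: span_base span_scale)
    moreover have "span {a, p, q, e} = UNIV" "radical = span {p, q, e}"
      using UNIV rad by (simp_all add: insert_commute)
    ultimately show ?thesis using main[of p q 0 "- u" "- w"] by simp
  qed
qed

section \<open>Radicals that are abelian modulo the annihilator\<close>

lemma listed_if_diagonal:
  assumes "e = x \<cdot> x" and "e \<in> annihilator" and "span {x, r, q, e} = UNIV"
    and "x \<cdot> r = - r" and "r \<cdot> x = r" and "x \<cdot> q = m \<odot> q" and "q \<cdot> x = - (m \<odot> q)"
    and "r \<cdot> r = 0" and "q \<cdot> q = 0" and "r \<cdot> q = 0" and "q \<cdot> r = 0"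
  shows listed
proof (rule listed_if_structure_constants[of "L24 (- m)" Entry24, OF _ dim_4 assms(3)])
  show "L24 (- m) \<in> algebras_of_entry Entry24" by auto
qed (use assms in \<open>simp add: annihilator_mul table_coordinates\<close>)

lemma listed_if_heisenberg:
  assumes "e = x \<cdot> x" and "e \<in> annihilator" and "span {x, r, q, e} = UNIV"
    and "x \<cdot> r = - r" and "r \<cdot> x = r" and "x \<cdot> q = q" and "q \<cdot> x = - q"
    and "r \<cdot> r = 0" and "q \<cdot> q = 0" and "r \<cdot> q = e" and "q \<cdot> r = - e"
  shows listed
proof (rule listed_if_structure_constants[of "L02" Entry02, OF _ dim_4 assms(3)])
qed (use assms in \<open>simp_all add: annihilator_mul table_coordinates\<close>)

lemma listed_if_jordan_block:
  assumes "e = x \<cdot> x" and "e \<in> annihilator" and "span {x, q, r, e} = UNIV"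
    and "x \<cdot> r = - r" and "r \<cdot> x = r" and "x \<cdot> q = - q - r" and "q \<cdot> x = q + r"
    and "r \<cdot> r = 0" and "q \<cdot> q = 0" and "r \<cdot> q = 0" and "q \<cdot> r = 0"
  shows listed
proof (rule listed_if_structure_constants[of "L30" Entry30, OF _ dim_4 assms(3)])
qed (use assms in \<open>simp_all add: annihilator_mul table_coordinates\<close>)

text \<open>Here \<open>x\<close> acts on the radical modulo \<open>e\<close> by a triangular matrix with diagonal entries \<open>-1\<close> and
  \<open>m\<close>. For \<open>m = 0\<close> the vector \<open>q\<close> plays the part of \<open>z\<close> in a bilinear form. For \<open>m \<noteq> 0\<close> the \<open>e\<close>
  component of \<open>xq\<close> can be removed, and the left Leibniz identity for \<open>x(rq)\<close> gives \<open>(m - 1) g = 0\<close>: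
  a nonzero product \<open>rq\<close> forces the eigenvalues to add up to zero, the eigenvalue of \<open>x\<close> on \<open>e\<close>.
  This is \<open>L02\<close>. If \<open>rq = 0\<close>, the algebra is determined by the matrix, which is diagonalizable
  (\<open>L24\<close>) or, for \<open>m = -1\<close>, possibly a Jordan block (\<open>L30\<close>).\<close>

lemma listed_if_triangular_normalized:
  assumes not_alt: "\<not> alternating mul" and ann: "annihilator = span {e}" and e_eq: "e = x \<cdot> x"
    and "e \<noteq> 0"
    and UNIV: "span {x, q, r, e} = UNIV" and r: "r \<in> radical" and q: "q \<in> radical"
    and xr: "x \<cdot> r = - r" and xq: "x \<cdot> q = k \<odot> r + m \<odot> q + t \<odot> e" and rq: "r \<cdot> q = g \<odot> e"
  shows listed
proof -
  have e: "e \<in> annihilator" by (simp add: ann span_base)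
  note zero [simp] = annihilator_mul[OF e]
  have rr: "r \<cdot> r = 0" and rx: "r \<cdot> x = r"
    using r radical_square_zero radical_anticommutes[of r x] xr by simp_all
  show listed
  proof (cases "m = 0")
    case True
    have "q \<cdot> r = (- g) \<odot> e" using radical_anticommutes[OF r, of q] rq by simp
    then have "q \<cdot> r \<in> span {r, e}" by (simp add: span_base span_neg span_scale)
    moreover have "x \<cdot> q \<in> span {r, e}" using xq True by (simp add: span_add span_base span_scale)
    ultimately show ?thesis
      using square_in_annihilator anticommutator_in_annihilator unfolding ann
      by (intro listed_if_eigenvector[OF not_alt e UNIV xr])
  next
    case m: False
    define q1 where "q1 = q + (t / m) \<odot> e"
    have q1: "q1 \<in> radical"
      using q e annihilator_in_radical subspace_radical
      by (auto simp: q1_def subspace_add subspace_scale)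
    have xq1: "x \<cdot> q1 = k \<odot> r + m \<odot> q1"
      using m xq by (simp add: q1_def bilinear algebra_simps)
    have rq1: "r \<cdot> q1 = g \<odot> e" using rq by (simp add: q1_def bilinear)
    have "x \<cdot> (r \<cdot> q1) = (x \<cdot> r) \<cdot> q1 + r \<cdot> (x \<cdot> q1)" by (rule left_leibniz)
    then have "(m * g - g) \<odot> e = 0"
      by (simp add: rq1 xr xq1 bilinear rr scale_left_diff_distrib)
    then have mg: "m * g = g" using \<open>e \<noteq> 0\<close> by simp
    have UNIV1: "span {x, q1, r, e} = UNIV"
    proof (rule span_UNIV_mono[OF UNIV])
      have "q \<in> span {x, q1, r, e}"
        by (rule in_span_4I[of _ 0 _ 1 _ 0 _ "- t / m"]) (simp add: q1_def)
      then show "y \<in> span {x, q1, r, e}" if "y \<in> {x, q, r, e}" for y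
        using that by (auto intro: span_base)
    qed
    have diagonal: listed
      if UNIV2: "span {x, q2, r, e} = UNIV" and q2: "q2 \<in> radical" and xq2: "x \<cdot> q2 = m \<odot> q2"
        and rq2: "r \<cdot> q2 = g \<odot> e" for q2
    proof -
      have anti: "q2 \<cdot> x = - (m \<odot> q2)" "q2 \<cdot> r = - (g \<odot> e)" and q2q2: "q2 \<cdot> q2 = 0"
        using radical_anticommutes[OF q2, of x] radical_anticommutes[OF r, of q2]
          radical_square_zero[OF q2] xq2 rq2 by simp_all
      show listed
      proof (cases "g = 0")
        case True
        then show ?thesis
          using e_eq e xr rx rr xq2 rq2 anti q2q2 UNIV2
          by (intro listed_if_diagonal[of e x r q2 m]) (simp_all add: insert_commute)
      next
        case False
        then have "m = 1" using mg by simp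
        have "span {x, (1 / g) \<odot> r, q2, e} = UNIV"
        proof (rule span_UNIV_mono[OF UNIV2])
          have "r \<in> span {x, (1 / g) \<odot> r, q2, e}"
            by (rule in_span_4I[of _ 0 _ g _ 0 _ 0]) (use False in simp)
          then show "y \<in> span {x, (1 / g) \<odot> r, q2, e}" if "y \<in> {x, q2, r, e}" for y
            using that by (auto intro: span_base)
        qed
        then show ?thesis
          using e_eq e xr rx rr xq2 rq2 anti q2q2 False \<open>m = 1\<close>
          by (intro listed_if_heisenberg[of e x "(1 / g) \<odot> r" q2]) (simp_all add: bilinear)
      qed
    qed
    show ?thesis
    proof (cases "m = - 1")
      case False
      then have m1: "m + 1 \<noteq> 0" by (simp add: add_eq_0_iff2)
      define c where "c = k / (m + 1)"
      have c: "c * (m + 1) = k" using m1 by (simp add: c_def)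
      define q2 where "q2 = q1 + c \<odot> r"
      have "x \<cdot> q2 = m \<odot> q2"
        using xq1 xr by (simp add: q2_def bilinear algebra_simps flip: c)
      moreover have "r \<cdot> q2 = g \<odot> e" using rq1 rr by (simp add: q2_def bilinear)
      moreover have "q2 \<in> radical"
        using q1 r subspace_radical by (simp add: q2_def subspace_add subspace_scale)
      moreover have "span {x, q2, r, e} = UNIV"
      proof (rule span_UNIV_mono[OF UNIV1])
        have "q1 \<in> span {x, q2, r, e}"
          by (rule in_span_4I[of _ 0 _ 1 _ "- c" _ 0]) (simp add: q2_def)
        then show "y \<in> span {x, q2, r, e}" if "y \<in> {x, q1, r, e}" for y
          using that by (auto intro: span_base)
      qed
      ultimately show ?thesis using diagonal by blast
    next
      case m: True
      have g: "g = 0" using mg m by simp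
      show ?thesis
      proof (cases "k = 0")
        case True
        then show ?thesis using diagonal[of q1] UNIV1 q1 xq1 rq1 by simp
      next
        case k: False
        have "q1 \<cdot> x = - (x \<cdot> q1)" by (simp add: radical_anticommutes[OF q1, of x])
        then have "q1 \<cdot> x = q1 - k \<odot> r" "q1 \<cdot> r = 0" "q1 \<cdot> q1 = 0"
          using radical_anticommutes[OF r, of q1]
            radical_square_zero[OF q1] xq1 rq1 g m by simp_all
        moreover have "span {x, q1, (- k) \<odot> r, e} = UNIV"
        proof (rule span_UNIV_mono[OF UNIV1])
          have "r \<in> span {x, q1, (- k) \<odot> r, e}"
            by (rule in_span_4I[of _ 0 _ 0 _ "- 1 / k" _ 0]) (use k in simp)
          then show "y \<in> span {x, q1, (- k) \<odot> r, e}" if "y \<in> {x, q1, r, e}" for y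
            using that by (auto intro: span_base)
        qed
        ultimately show ?thesis
          using e_eq e xr rx rr xq1 rq1 g m
          by (intro listed_if_jordan_block[of e x q1 "(- k) \<odot> r"]) (simp_all add: bilinear)
      qed
    qed
  qed
qed

text \<open>Dividing \<open>a\<close> by \<open>- l\<close> normalizes the eigenvalue on \<open>p\<close> to \<open>-1\<close>; this rescales the square \<open>aa\<close>
  by \<open>1 / l\<^sup>2\<close>, which is why \<open>e\<close> differs from \<open>aa\<close> in the proof.\<close>

lemma listed_if_triangular:
  assumes not_alt: "\<not> alternating mul" and ann: "annihilator = span {a \<cdot> a}" and aa: "a \<cdot> a \<noteq> 0"
    and UNIV: "span {a, q, p, a \<cdot> a} = UNIV" and p: "p \<in> radical" and q: "q \<in> radical"
    and ap: "a \<cdot> p = l \<odot> p + s \<odot> (a \<cdot> a)" and aq: "a \<cdot> q = k \<odot> p + m \<odot> q + t \<odot> (a \<cdot> a)"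
    and pq: "p \<cdot> q \<in> span {a \<cdot> a}" and l: "l \<noteq> 0"
  shows listed
proof -
  define d where "d = a \<cdot> a"
  have d: "d \<in> annihilator" by (simp add: d_def square_in_annihilator)
  note zero [simp] = annihilator_mul[OF d]
  define x where "x = (- 1 / l) \<odot> a"
  define r where "r = p + (s / l) \<odot> d"
  define e where "e = x \<cdot> x"
  have e_d: "e = (1 / l\<^sup>2) \<odot> d" by (simp add: e_def x_def d_def bilinear power2_eq_square)
  then have d_e: "d = l\<^sup>2 \<odot> e" using l by simp
  have "e \<in> span {d}" "d \<in> span {e}" using e_d d_e span_1 by blast+
  then have span_e: "span {e} = span {d}" by (simp add: span_eq)
  have "span {x, q, r, e} = UNIV"
  proof (rule span_UNIV_mono[OF UNIV[folded d_def]])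
    have "a \<in> span {x, q, r, e}"
      by (rule in_span_4I[of _ "- l" _ 0 _ 0 _ 0]) (use l in \<open>simp add: x_def\<close>)
    moreover have "p \<in> span {x, q, r, e}"
      by (rule in_span_4I[of _ 0 _ 0 _ 1 _ "- s * l"])
        (use l in \<open>simp add: r_def e_d power2_eq_square\<close>)
    moreover have "d \<in> span {x, q, r, e}"
      by (rule in_span_4I[of _ 0 _ 0 _ 0 _ "l\<^sup>2"]) (use d_e in simp)
    ultimately show "y \<in> span {x, q, r, e}" if "y \<in> {a, q, p, d}" for y
      using that by (auto intro: span_base)
  qed
  moreover have "r \<in> radical"
    using p d annihilator_in_radical subspace_radical
      by (auto simp: r_def subspace_add subspace_scale)
  moreover have "x \<cdot> r = - r"
    using ap l by (simp add: x_def r_def bilinear algebra_simps flip: d_def)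
  moreover have "x \<cdot> q = (- k / l) \<odot> r + (- m / l) \<odot> q + (k * s - t * l) \<odot> e"
    using aq l unfolding e_d
    by (simp add: x_def r_def bilinear algebra_simps power2_eq_square diff_divide_distrib
      flip: d_def)
  moreover obtain g where "r \<cdot> q = g \<odot> e"
  proof -
    have "r \<cdot> q = p \<cdot> q" by (simp add: r_def bilinear)
    then have "r \<cdot> q \<in> span {e}" using pq span_e by (simp add: d_def)
    then show thesis using that span_1 by blast
  qed
  moreover have "annihilator = span {e}" using ann span_e by (simp add: d_def)
  moreover have "e \<noteq> 0" using aa l by (simp add: e_d d_def)
  ultimately show listed
    using listed_if_triangular_normalized[OF not_alt _ e_def _ _ _ q] by blast
qed

lemma complex_quadratic_root:
  fixes a b c :: complex
  assumes "a \<noteq> 0"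
  obtains z where "a * z\<^sup>2 + b * z + c = 0"
proof -
  define s where "s = csqrt (b\<^sup>2 - 4 * a * c)"
  have s2: "s\<^sup>2 = b\<^sup>2 - 4 * a * c" by (simp add: s_def)
  have "4 * a * (a * ((s - b) / (2 * a))\<^sup>2 + b * ((s - b) / (2 * a)) + c)
    = (s - b)\<^sup>2 + 2 * b * (s - b) + 4 * a * c"
    using assms by (simp add: field_simps power2_eq_square)
  also have "\<dots> = s\<^sup>2 - b\<^sup>2 + 4 * a * c" by (simp add: power2_eq_square algebra_simps)
  also have "\<dots> = 0" by (simp add: s2)
  finally show thesis using that[of "(s - b) / (2 * a)"] assms by simp
qed

text \<open>Left multiplication by \<open>a\<close> preserves the radical and has an eigenvector there modulo \<open>e\<close>. If
  \<open>p\<close> is not one, then some \<open>cp + q\<close> is, for a root \<open>c\<close> of a quadratic equation.\<close>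

lemma triangular_basis:
  assumes UNIV: "span {a, q, p, e} = UNIV" and rad: "radical = span {q, p, e}"
  obtains p' q' l s k m t where "span {a, q', p', e} = UNIV" "p' \<in> radical" "q' \<in> radical"
    "a \<cdot> p' = l \<odot> p' + s \<odot> e" "a \<cdot> q' = k \<odot> p' + m \<odot> q' + t \<odot> e"
proof -
  have p: "p \<in> radical" and q: "q \<in> radical" and e: "e \<in> radical" by (simp_all add: rad span_base)
  obtain \<beta> \<alpha> s where ap: "a \<cdot> p = \<beta> \<odot> q + \<alpha> \<odot> p + s \<odot> e"
    using product_in_radical[of a p] by (auto simp: rad span_3)
  obtain \<delta> \<gamma> t where aq: "a \<cdot> q = \<delta> \<odot> q + \<gamma> \<odot> p + t \<odot> e"
    using product_in_radical[of a q] by (auto simp: rad span_3)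
  show thesis
  proof (cases "\<beta> = 0")
    case True
    show thesis
      by (rule that[OF UNIV p q, of \<alpha> s \<gamma> \<delta> t]) (simp_all add: ap aq True)
  next
    case False
    then obtain c where c: "\<beta> * c\<^sup>2 + (\<delta> - \<alpha>) * c + - \<gamma> = 0" using complex_quadratic_root by blast
    have \<gamma>: "\<gamma> = \<beta> * c\<^sup>2 + (\<delta> - \<alpha>) * c" using c by simp
    define p' where "p' = c \<odot> p + q"
    have "span {a, p, p', e} = UNIV"
    proof (rule span_UNIV_mono[OF UNIV])
      have "q \<in> span {a, p, p', e}"
        by (rule in_span_4I[of _ 0 _ "- c" _ 1 _ 0]) (simp add: p'_def)
      then show "y \<in> span {a, p, p', e}" if "y \<in> {a, q, p, e}" for y
        using that by (auto intro: span_base)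
    qed
    moreover have "p' \<in> radical"
      using p q subspace_radical by (simp add: p'_def subspace_add subspace_scale)
    moreover have "a \<cdot> p' = (c * \<beta> + \<delta>) \<odot> p' + (c * s + t) \<odot> e"
      by (simp add: p'_def bilinear ap aq \<gamma> algebra_simps power2_eq_square)
    moreover have "a \<cdot> p = \<beta> \<odot> p' + (\<alpha> - c * \<beta>) \<odot> p + s \<odot> e"
      by (simp add: p'_def bilinear ap algebra_simps)
    ultimately show thesis using that p by blast
  qed
qed

text \<open>Of the two eigenvalues \<open>l\<close> and \<open>m\<close> of \<open>a\<close> on the radical modulo \<open>e\<close> one is nonzero, because
  otherwise triple products would be annihilating. If only \<open>m\<close> is nonzero, then an eigenvector for
  \<open>m\<close> exchanges places with \<open>p\<close>.\<close>

lemma listed_if_radical_abelian: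
  assumes not_nil: "\<not> nilpotent_algebra mul" and not_alt: "\<not> alternating mul"
    and ann: "annihilator = span {a \<cdot> a}" and aa: "a \<cdot> a \<noteq> 0"
    and UNIV: "span {a, q, p, a \<cdot> a} = UNIV" and rad: "radical = span {q, p, a \<cdot> a}"
    and pq: "p \<cdot> q \<in> span {a \<cdot> a}"
  shows listed
proof -
  define e where "e = a \<cdot> a"
  have e: "e \<in> annihilator" by (simp add: e_def square_in_annihilator)
  note zero [simp] = annihilator_mul[OF e]
  note rad = rad[folded e_def] and pq = pq[folded e_def]
  have prod: "y \<cdot> z \<in> span {e}" if yz: "y \<in> radical" "z \<in> radical" for y z
  proof -
    have "p \<in> radical" "q \<in> radical" by (simp_all add: rad span_base)
    then have *: "p \<cdot> p = 0" "q \<cdot> q = 0" "q \<cdot> p = - (p \<cdot> q)"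
      using radical_square_zero radical_anticommutes by blast+
    obtain s t c where "y = s \<odot> q + t \<odot> p + c \<odot> e" using yz(1) by (auto simp: rad span_3)
    moreover obtain s' t' c' where "z = s' \<odot> q + t' \<odot> p + c' \<odot> e"
      using yz(2) by (auto simp: rad span_3)
    ultimately have "y \<cdot> z = (t * s' - s * t') \<odot> (p \<cdot> q)"
      by (simp add: bilinear * scale_left_diff_distrib mult.commute)
    then show ?thesis using pq by (simp only: span_scale)
  qed
  obtain p q l s k m t where UNIV: "span {a, q, p, e} = UNIV" and p: "p \<in> radical"
    and q: "q \<in> radical"
    and ap: "a \<cdot> p = l \<odot> p + s \<odot> e" and aq: "a \<cdot> q = k \<odot> p + m \<odot> q + t \<odot> e"
    by (rule triangular_basis[OF UNIV[folded e_def] rad])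
  note triangular = listed_if_triangular[OF not_alt ann aa, folded e_def]
  show listed
  proof (cases "l = 0")
    case False
    then show ?thesis using triangular[OF UNIV p q ap aq] prod p q by blast
  next
    case l: True
    show ?thesis
    proof (cases "m = 0")
      case m: False
      define q' where "q' = q + (k / m) \<odot> p"
      have q': "q' \<in> radical"
        using p q subspace_radical by (simp add: q'_def subspace_add subspace_scale)
      have "span {a, p, q', e} = UNIV"
      proof (rule span_UNIV_mono[OF UNIV])
        have "q \<in> span {a, p, q', e}"
          by (rule in_span_4I[of _ 0 _ "- k / m" _ 1 _ 0]) (simp add: q'_def)
        then show "y \<in> span {a, p, q', e}" if "y \<in> {a, q, p, e}" for y
          using that by (auto intro: span_base)
      qed
      moreover have "a \<cdot> q' = m \<odot> q' + (t + k / m * s) \<odot> e"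
        using m ap l by (simp add: q'_def bilinear aq algebra_simps)
      moreover have "a \<cdot> p = 0 \<odot> q' + 0 \<odot> p + s \<odot> e" using ap l by simp
      ultimately show ?thesis using triangular[OF _ q' p] prod p q' m by blast
    next
      case m: True
      have decompose: "\<exists>s v. y = s \<odot> a + v \<and> v \<in> radical" for y
      proof -
        obtain s t u w where "y = s \<odot> a + t \<odot> q + u \<odot> p + w \<odot> e" using UNIV span_4 by blast
        moreover have "t \<odot> q + u \<odot> p + w \<odot> e \<in> radical"
          using p q e annihilator_in_radical subspace_radical
            by (auto simp: subspace_add subspace_scale)
        ultimately show ?thesis by (metis add.assoc)
      qed
      have e_span: "e \<in> span {p, e}" "span {e} \<subseteq> span {p, e}"
        by (auto simp: span_base intro: span_mono[THEN subsetD])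
      have av: "a \<cdot> v \<in> span {p, e}" if "v \<in> radical" for v
      proof -
        obtain s' t' u w where "v = s' \<odot> a + t' \<odot> q + u \<odot> p + w \<odot> e" using UNIV span_4 by blast
        then have "a \<cdot> v = (t' * k) \<odot> p + (s' + t' * t + u * s) \<odot> e"
          by (simp add: bilinear ap aq l m algebra_simps flip: e_def)
        then show ?thesis using span_2 by blast
      qed
      have yz: "y \<cdot> z \<in> span {p, e}" for y z
      proof -
        obtain c v d w where y: "y = c \<odot> a + v" "v \<in> radical" and z: "z = d \<odot> a + w" "w \<in> radical"
          using decompose by metis
        have "y \<cdot> z = (c * d) \<odot> e + c \<odot> (a \<cdot> w) - d \<odot> (a \<cdot> v) + v \<cdot> w"
          using radical_anticommutes[OF y(2), of a]
            by (simp add: y(1) z(1) bilinear algebra_simps flip: e_def)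
        moreover have "v \<cdot> w \<in> span {p, e}" using prod y(2) z(2) e_span by blast
        ultimately show ?thesis
          using av y(2) z(2) e_span(1) by (simp add: span_add span_diff span_scale)
      qed
      have pz: "p \<cdot> z \<in> span {e}" for z
      proof -
        obtain d w where z: "z = d \<odot> a + w" "w \<in> radical" using decompose by blast
        have "p \<cdot> a = - (a \<cdot> p)" by (simp add: radical_anticommutes[OF p, of a])
        then have "p \<cdot> z = (- d * s) \<odot> e + p \<cdot> w"
          using ap l by (simp add: z(1) bilinear)
        then show ?thesis using prod p z(2) by (simp add: span_diff span_scale span_base)
      qed
      have "(x \<cdot> y) \<cdot> z \<in> annihilator" for x y z
      proof -
        obtain c d where "x \<cdot> y = c \<odot> p + d \<odot> e" using yz span_2 by blast
        then show ?thesis using pz[of z] ann by (simp add: bilinear span_scale flip: e_def)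
      qed
      then show ?thesis using not_nil nilpotent_if_triple_products_annihilate by blast
    qed
  qed
qed

lemma listed_if_not_nilpotent_not_alternating:
  assumes not_nil: "\<not> nilpotent_algebra mul" and not_alt: "\<not> alternating mul"
  shows listed
proof -
  obtain a where aa: "a \<cdot> a \<noteq> 0" using not_alt by (auto simp: alternating_def)
  define e where "e = a \<cdot> a"
  have "e \<noteq> 0" and e: "e \<in> annihilator" using aa by (simp_all add: e_def square_in_annihilator)
  show listed
  proof (cases "annihilator \<subseteq> span {e}")
    case False
    then show ?thesis using listed_if_large_annihilator[OF not_nil not_alt aa] by (auto simp: e_def)
  next
    case True
    moreover have "span {e} \<subseteq> annihilator" using e by (intro span_annihilator) simp
    ultimately have ann: "annihilator = span {e}" by blast
    have "\<not> radical \<subseteq> span {e}"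
    proof
      assume "radical \<subseteq> span {e}"
      then have "(x \<cdot> y) \<cdot> z \<in> annihilator" for x y z
        using product_in_radical by (auto simp: ann)
      then show False using not_nil nilpotent_if_triple_products_annihilate by blast
    qed
    then obtain p where p: "p \<in> radical" "p \<notin> span {e}" by blast
    show ?thesis
    proof (cases "radical \<subseteq> span {p, e}")
      case True
      then show ?thesis using listed_if_small_radical[OF not_nil not_alt aa ann \<open>e \<noteq> 0\<close> p] by simp
    next
      case False
      then obtain q where q: "q \<in> radical" "q \<notin> span {p, e}" by blast
      have sub: "span {q, p, e} \<subseteq> radical"
        using p q e annihilator_in_radical subspace_radical by (intro span_minimal) auto
      have "a \<notin> radical" using aa radical_square_zero by blast
      then have UNIV: "span {a, q, p, e} = UNIV"
        using sub p q \<open>e \<noteq> 0\<close> by (intro independent_quadruple_spans[OF dim_4]) auto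
      have "y \<in> span {q, p, e}" if y: "y \<in> radical" for y
      proof -
        obtain s t u w where eq: "y = s \<odot> a + t \<odot> q + u \<odot> p + w \<odot> e" using UNIV span_4 by blast
        have "s \<odot> a = y - (t \<odot> q + u \<odot> p + w \<odot> e)" by (simp add: eq)
        also have "\<dots> \<in> radical"
          using sub span_3 by (intro subspace_diff[OF subspace_radical y]) blast
        finally have "(1 / s) \<odot> (s \<odot> a) \<in> radical" by (rule subspace_scale[OF subspace_radical])
        with \<open>a \<notin> radical\<close> have "s = 0" by (auto split: if_splits)
        then show ?thesis using eq by (auto simp: span_3)
      qed
      with sub have rad: "radical = span {q, p, e}" by blast
      show ?thesis
      proof (cases "p \<cdot> q \<in> span {e}")
        case True
        then show ?thesis
          using listed_if_radical_abelian[OF not_nil not_alt _ aa, of q p] ann UNIV rad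
            by (simp add: e_def)
      next
        case False
        then show ?thesis by (rule listed_if_radical_nonabelian[OF not_alt ann \<open>e \<noteq> 0\<close> UNIV rad])
      qed
    qed
  qed
qed

end

section \<open>The classification\<close>

text \<open>Already the algebras \<open>L35 \<alpha>\<close> with \<open>\<alpha> \<noteq> - 1\<close> are pairwise not isomorphic.\<close>

lemma infinitely_many_isomorphism_classes:
  "infinite ({m :: product4. nonnilpotent_nonlie_symmetric_leibniz_4 (*s) m}
     // isomorphism_relation4)" (is "infinite ?Q")
proof
  let ?class = "\<lambda>\<alpha>. isomorphism_relation4 `` {L35 \<alpha>}"
  assume "finite ?Q"
  have refl: "L35 \<alpha> \<in> ?class \<alpha>" for \<alpha>
  proof -
    have "Vector_Spaces.linear (*s) (*s) (\<lambda>x :: complex ^ 4. x)" by (rule vec.linear_ident)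
    then show ?thesis
      unfolding isomorphism_relation4_def algebra_isomorphic_def
      by (auto intro!: exI[of _ "\<lambda>x. x"] simp: bij_betw_def)
  qed
  have "inj_on ?class (- {- 1})"
  proof (rule inj_onI)
    fix \<alpha> \<beta>
    assume eq: "?class \<alpha> = ?class \<beta>"
    have "L35 \<beta> \<in> ?class \<alpha>" unfolding eq by (rule refl)
    then have "algebra_isomorphic (*s) (L35 \<alpha>) (*s) (L35 \<beta>)"
      by (simp add: isomorphism_relation4_def)
    then show "\<alpha> = \<beta>"
      using operator_ratio_isomorphic[of "(*s)" "L35 \<alpha>" "(*s)" "L35 \<beta>" \<beta>]
      by (simp add: operator_ratio_L35)
  qed
  moreover have "?class ` (- {- 1}) \<subseteq> ?Q"
    using algebras_of_entry_satisfy_hypotheses[of _ Entry35] by (auto intro!: quotientI)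
  ultimately have "finite (- {- 1 :: complex})"
    using \<open>finite ?Q\<close> finite_subset finite_imageD by blast
  then show False
    using infinite_UNIV_char_0[where 'a = complex] by (simp add: finite_compl)
qed

theorem theoremB:
  shows "infinite ({m :: product4. nonnilpotent_nonlie_symmetric_leibniz_4 (*s) m}
                     // isomorphism_relation4)
    \<and> (\<forall>entry. \<forall>m \<in> algebras_of_entry entry. nonnilpotent_nonlie_symmetric_leibniz_4 (*s) m)
    \<and> (\<forall>(smul :: complex \<Rightarrow> 'a::ab_group_add \<Rightarrow> 'a) (mul :: 'a \<Rightarrow> 'a \<Rightarrow> 'a).
         nonnilpotent_nonlie_symmetric_leibniz_4 smul mul \<longrightarrow>
         (\<exists>!entry. \<exists>m \<in> algebras_of_entry entry. algebra_isomorphic smul mul (*s) m))"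
proof (intro conjI allI impI ballI)
  show "infinite ({m :: product4. nonnilpotent_nonlie_symmetric_leibniz_4 (*s) m}
      // isomorphism_relation4)"
    by (rule infinitely_many_isomorphism_classes)
next
  show "nonnilpotent_nonlie_symmetric_leibniz_4 (*s) m" if "m \<in> algebras_of_entry entry" for m entry
    using that by (rule algebras_of_entry_satisfy_hypotheses)
next
  fix smul :: "complex \<Rightarrow> 'a \<Rightarrow> 'a" and mul :: "'a \<Rightarrow> 'a \<Rightarrow> 'a"
  assume *: "nonnilpotent_nonlie_symmetric_leibniz_4 smul mul"
  then interpret symmetric_leibniz_algebra_4 smul mul
    by (simp add: nonnilpotent_nonlie_symmetric_leibniz_4_def symmetric_leibniz_algebra_4_def
        symmetric_leibniz_algebra_4_axioms_def)
  have listed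
    using * listed_if_not_nilpotent_not_alternating
    by (simp add: nonnilpotent_nonlie_symmetric_leibniz_4_def)
  moreover have "entry = entry_of mul"
    if "\<exists>m\<in>algebras_of_entry entry. algebra_isomorphic smul mul (*s) m" for entry
    using that entry_of_isomorphic entry_of_listed by metis
  ultimately show "\<exists>!entry. \<exists>m\<in>algebras_of_entry entry. algebra_isomorphic smul mul (*s) m"
    unfolding isomorphic_to_listed_def by metis
qed

end
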